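(* Let $s,t_1,t_2\in V$ be three vertices such that $s>t_2>t_1$ and $s>3$. When $P_{n,K}$ is full-dimensional, the inequality $$x_{s,t_1}+x_{s,t_2}-x_{t_1,t_2}+x_s\le 1$$ is facet-defining for $P_{n,K}$ if and only if $t_2>3$ or $K\le n-3$.
   Context: $V=\{1,\dots,n\}$ and $E$ is the set of all unordered pairs $ij$ of distinct elements of $V$; $x_{i,j}=x_{j,i}$. A $K$-partition $\pi$ is a collection of $K$ non-empty pairwise disjoint subsets (clusters) of $V$ whose union is $V$. The representative of a cluster is its smallest element. The characteristic vector $x^\pi\in\{0,1\}^{|E|+|V|-3}$ of $\pi$ has components $x_4,\dots,x_n$ and $x_{i,j}$ for $ij\in E$, where $x^\pi_{i,j}=1$ if $i,j$ are in the same cluster and $0$ otherwise, and $x^\pi_u=1$ if $u$ is the representative of its cluster and $0$ otherwise. (Representative variables of vertices $1,2,3$ are not coordinates.) $P_{n,K}\subset\mathbb R^{|E|+|V|-3}$ is the convex hull of the characteristic vectors $x^\pi$ of all $K$-partitions $\pi$ of $V$ (equivalently, of all $0/1$ solutions of the integer formulation of the $K$-partitioning problem). It is full-dimensional (dimension $|E|+|V|-3$) if and only if $K\in\{3,\dots,n-2\}$. An inequality is facet-defining for $P_{n,K}$ if it is valid for $P_{n,K}$ and the set of points of $P_{n,K}$ satisfying it with equality has dimension $\dim(P_{n,K})-1$. *)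

theory Defs
  imports "HOL-Analysis.Analysis" "HOL-Library.Disjoint_Sets"
begin

definition edges :: "nat \<Rightarrow> nat set set" where
  "edges n = {{i, j} | i j. i \<in> {1..n} \<and> j \<in> {1..n} \<and> i \<noteq> j}"

definition K_partition :: "nat \<Rightarrow> nat \<Rightarrow> nat set set \<Rightarrow> bool" where
  "K_partition n K \<pi> \<longleftrightarrow> partition_on {1..n} \<pi> \<and> card \<pi> = K"

definition same_cluster :: "nat set set \<Rightarrow> nat set \<Rightarrow> bool" where
  "same_cluster \<pi> e \<longleftrightarrow> (\<exists>C\<in>\<pi>. e \<subseteq> C)"

definition representative :: "nat set set \<Rightarrow> nat \<Rightarrow> bool" where
  "representative \<pi> u \<longleftrightarrow> (\<exists>C\<in>\<pi>. u = Min C)"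

text \<open>The names of the coordinates: \<open>Edge {i, j}\<close> stands for $x_{i,j} = x_{j,i}$ and
  \<open>Rep u\<close> for $x_u$. The vertices 1, 2, 3 have no representative coordinate.\<close>

datatype coord = Edge "nat set" | Rep nat

definition coords :: "nat \<Rightarrow> coord set" where
  "coords n = Edge ` edges n \<union> Rep ` {4..n}"

text \<open>The ambient space $R^{|E|+|V|-3}$ is \<^typ>\<open>real ^ 'd\<close>, where the elements of the index
  type are labelled by the coordinate names through a bijection \<open>ix\<close> from \<^typ>\<open>'d\<close> to
  \<^term>\<open>coords n\<close>. Any type with the right number of elements has such a labelling
  (lemmas \<open>card_coords\<close> and \<open>ex_labelling\<close> below).\<close>

definition entry :: "('d \<Rightarrow> coord) \<Rightarrow> real ^ 'd \<Rightarrow> coord \<Rightarrow> real" where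
  "entry ix x c = x $ (inv ix c)"

definition char_vec :: "('d \<Rightarrow> coord) \<Rightarrow> nat set set \<Rightarrow> real ^ 'd" where
  "char_vec ix \<pi> = (\<chi> d. case ix d of
       Edge e \<Rightarrow> (if same_cluster \<pi> e then 1 else 0)
     | Rep u \<Rightarrow> (if representative \<pi> u then 1 else 0))"

definition partition_polytope :: "('d \<Rightarrow> coord) \<Rightarrow> nat \<Rightarrow> nat \<Rightarrow> (real ^ 'd) set" where
  "partition_polytope ix n K = convex hull {char_vec ix \<pi> | \<pi>. K_partition n K \<pi>}"

definition full_dimensional :: "'a::euclidean_space set \<Rightarrow> bool" where
  "full_dimensional P \<longleftrightarrow> aff_dim P = int DIM('a)"

text \<open>The inequality \<open>lhs x \<le> rhs\<close> is facet-defining for \<open>P\<close>.\<close>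

definition facet_defining :: "'a::euclidean_space set \<Rightarrow> ('a \<Rightarrow> real) \<Rightarrow> real \<Rightarrow> bool" where
  "facet_defining P lhs rhs \<longleftrightarrow>
     (\<forall>x\<in>P. lhs x \<le> rhs) \<and> aff_dim {x \<in> P. lhs x = rhs} = aff_dim P - 1"

lemma finite_edges: "finite (edges n)"
  by (rule finite_subset[of _ "Pow {1..n}"]) (auto simp: edges_def)

lemma finite_coords: "finite (coords n)"
  by (simp add: coords_def finite_edges)

lemma card_coords:
  assumes "3 \<le> n"
  shows "card (coords n) = card (edges n) + n - 3"
proof -
  have "card (coords n) = card (Edge ` edges n) + card (Rep ` {4..n})"
    unfolding coords_def by (rule card_Un_disjoint) (auto simp: finite_edges)
  also have "\<dots> = card (edges n) + card {4..n}"
    by (simp add: card_image inj_on_def)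
  finally show ?thesis using assms by simp
qed

lemma ex_labelling:
  assumes "CARD('d::finite) = card (coords n)"
  shows "\<exists>ix. bij_betw ix (UNIV :: 'd set) (coords n)"
  using finite_same_card_bij[OF _ finite_coords assms] by simp

end

theory Submission
  imports Defs
begin

text \<open>
  A partition is encoded as a colouring \<open>c\<close> of the vertices, its \<open>K\<close> clusters being the
  colour classes, so that moving a vertex between clusters is a function update. Let a linear form be
  constant on the colourings for which the inequality is tight, normalised by subtracting a multiple
  of the inequality so that its coefficient on \<open>{s, t1}\<close> vanishes; the inequality defines a facet as
  soon as every such form is zero. Moving two vertices \<open>v\<close>, \<open>w\<close> independently and
  taking the mixed second difference isolates the coefficient of \<open>{v, w}\<close>, which kills all
  edges except those inside \<open>{1, 2, 3}\<close> and \<open>{s, t1, t2}\<close>; moving a single vertex deals with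
  the latter. Exchanging which of two vertices is a representative shows that all
  coefficients of representatives agree. What is left is determined by the trace of the
  partition on \<open>{1, 2, 3}\<close>, and the five possible traces give a regular linear system.
  Only the trace with 1, 2, 3 together can be unavailable: if \<open>t2 \<le> 3\<close>, it forces a cluster
  containing 1, 2, 3 and \<open>s\<close>, which needs \<open>K \<le> n - 3\<close>.

  The converse and the bounds \<open>3 \<le> K \<le> n - 2\<close> come from the identity
  \<open>(\<Sum>u\<ge>4. x\<^sub>u) - (x\<^sub>1\<^sub>2 + x\<^sub>1\<^sub>3 + x\<^sub>2\<^sub>3) = K - 3 - \<delta>\<close>,
  where \<open>\<delta> = 1\<close> if 1, 2, 3 share a cluster and \<open>\<delta> = 0\<close> otherwise: where \<open>\<delta>\<close> vanishes
  (or is an affine function of \<open>x\<^sub>1\<^sub>2 + x\<^sub>1\<^sub>3 + x\<^sub>2\<^sub>3\<close>, as for \<open>K \<le> 2\<close>) it is a linear equation.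
\<close>

section \<open>Colourings\<close>

definition monochromatic :: "(nat \<Rightarrow> nat) \<Rightarrow> nat set \<Rightarrow> bool" where
  "monochromatic c e \<longleftrightarrow> (\<exists>k. \<forall>i\<in>e. c i = k)"

text \<open>The colour counterpart of \<open>representative\<close>. The range starts at 1 so that
  the value of \<open>c\<close> at 0, which is not a vertex, has no influence.\<close>

definition first_of_colour :: "(nat \<Rightarrow> nat) \<Rightarrow> nat \<Rightarrow> bool" where
  "first_of_colour c u \<longleftrightarrow> (\<forall>v\<in>{1..<u}. c v \<noteq> c u)"

text \<open>The value of the linear form with coefficients \<open>E\<close> and \<open>R\<close> at
  the characteristic vector of the colour classes (see \<open>inner_colour_vec\<close>); it keeps
  vectors out of the combinatorial part.\<close>

definition weight :: "nat \<Rightarrow> (nat set \<Rightarrow> real) \<Rightarrow> (nat \<Rightarrow> real) \<Rightarrow> (nat \<Rightarrow> nat) \<Rightarrow> real" where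
  "weight n E R c = (\<Sum>e\<in>edges n. E e * of_bool (monochromatic c e))
     + (\<Sum>u\<in>{4..n}. R u * of_bool (first_of_colour c u))"

lemma monochromatic_pair [simp]: "monochromatic c {i, j} \<longleftrightarrow> c i = c j"
  by (auto simp: monochromatic_def)

lemma monochromatic_upd: "v \<notin> e \<Longrightarrow> monochromatic (c(v := a)) e \<longleftrightarrow> monochromatic c e"
proof -
  assume "v \<notin> e"
  then have "(c(v := a)) i = c i" if "i \<in> e" for i using that by auto
  then show ?thesis by (simp add: monochromatic_def del: fun_upd_apply)
qed

lemma edgesE:
  assumes "e \<in> edges n"
  obtains i j where "e = {i, j}" "i \<in> {1..n}" "j \<in> {1..n}" "i \<noteq> j"
  using assms by (auto simp: edges_def)

lemma edgesE_max:
  assumes "e \<in> edges n"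
  obtains v w where "e = {v, w}" "v \<in> {1..n}" "w \<in> {1..n}" "w < v"
proof -
  obtain i j where *: "e = {i, j}" "i \<in> {1..n}" "j \<in> {1..n}" "i \<noteq> j"
    using assms by (rule edgesE)
  show ?thesis
  proof (cases "i < j")
    case True
    then show ?thesis using that[of j i] * by (auto simp: insert_commute)
  next
    case False
    then show ?thesis using that[of i j] * by auto
  qed
qed

lemma edges_pairI: "i \<in> {1..n} \<Longrightarrow> j \<in> {1..n} \<Longrightarrow> i \<noteq> j \<Longrightarrow> {i, j} \<in> edges n"
  by (auto simp: edges_def)

text \<open>Giving fresh, distinct colours to vertices outside \<open>B\<close> raises the number of
  colours one at a time and only ever splits colour classes.\<close>

lemma refine_colouring:
  fixes c0 :: "nat \<Rightarrow> nat"
  assumes fin: "finite W" and BW: "B \<subseteq> W" and im: "c0 ` W \<subseteq> c0 ` B"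
    and K: "card (c0 ` B) \<le> K" "K \<le> card (c0 ` B) + card (W - B)"
  obtains c where "card (c ` W) = K" "\<And>i. i \<in> B \<Longrightarrow> c i = c0 i"
    "\<And>i j. i \<in> W \<Longrightarrow> j \<in> W \<Longrightarrow> c i = c j \<Longrightarrow> c0 i = c0 j"
proof -
  obtain R where R: "R \<subseteq> W - B" "card R = K - card (c0 ` B)"
    using K by (metis le_diff_conv add.commute obtain_subset_with_card_n)
  \<comment> \<open>\<open>M\<close> exceeds every colour that \<open>c0\<close> uses on
    \<open>W\<close>, so the colours \<open>M + i\<close> are new and pairwise distinct.\<close>
  define M where "M = Suc (Max (c0 ` W))"
  define c where "c = (\<lambda>i. if i \<in> R then M + i else c0 i)"
  have less: "c0 i < M" if "i \<in> W" for i
    using that fin by (auto simp: M_def less_Suc_eq_le)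
  have "c ` W = c0 ` B \<union> (\<lambda>i. M + i) ` R"
    using R BW im by (auto simp: c_def image_iff subset_iff; metis)
  moreover have "c0 ` B \<inter> (\<lambda>i. M + i) ` R = {}"
    using less BW by fastforce
  moreover have "card ((\<lambda>i. M + i) ` R) = card R"
    by (rule card_image) simp
  ultimately have "card (c ` W) = card (c0 ` B) + card R"
    using fin BW R by (metis card_Un_disjoint finite_Diff finite_imageI finite_subset)
  then have 1: "card (c ` W) = K" using R K by simp
  show ?thesis
  proof (rule that[of c, OF 1])
    show "c i = c0 i" if "i \<in> B" for i using that R by (auto simp: c_def)
    show "c0 i = c0 j" if "i \<in> W" "j \<in> W" "c i = c j" for i j
      using that less[of i] less[of j] by (auto simp: c_def split: if_splits)
  qed
qed

section \<open>Effect of moving one or two vertices\<close>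

text \<open>The right-hand side is free of \<open>a\<close>: two target colours for \<open>v\<close>
  that both meet the condition give \<open>u\<close> the same status.\<close>

lemma first_of_colour_upd:
  assumes "u \<noteq> v" "v < u \<Longrightarrow> c u = a \<Longrightarrow> \<exists>x\<in>{1..<u} - {v}. c x = c u"
  shows "first_of_colour (c(v := a)) u \<longleftrightarrow> (\<forall>x\<in>{1..<u} - {v}. c x \<noteq> c u)"
  using assms unfolding first_of_colour_def by (cases "v < u \<and> c u = a") auto

text \<open>Only the edge \<open>{v, w}\<close> feels both moves; it is monochromatic for
  \<open>p, p\<close> and, if \<open>q = r\<close>, also for \<open>q, r\<close>, whence the factor
  1 or 2. The term of a representative cancels as soon as its status ignores one of the moves, which
  the early vertex \<open>x\<close> of colour \<open>p\<close> (and, if \<open>q = r\<close>,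
  \<open>y\<close> of colour \<open>q\<close>) ensures.\<close>

lemma weight_mixed_difference:
  assumes vw: "v \<in> {1..n}" "w \<in> {1..n}" "v \<noteq> w" and pqr: "p \<noteq> q" "p \<noteq> r"
    and x: "x \<in> {1..n}" "x \<noteq> v" "x \<noteq> w" "c x = p"
    and alt: "q \<noteq> r \<and> (x < v \<or> x < w)
      \<or> q = r \<and> x < v \<and> y < v \<and> y \<noteq> w \<and> y \<in> {1..n} \<and> c y = q"
  shows "weight n E R (c(v := p, w := p)) - weight n E R (c(v := q, w := p))
       - weight n E R (c(v := p, w := r)) + weight n E R (c(v := q, w := r))
       = E {v, w} * (1 + of_bool (q = r))"
proof -
  let ?c = "\<lambda>a b. c(v := a, w := b)"
  have e: "E e * of_bool (monochromatic (?c p p) e) - E e * of_bool (monochromatic (?c q p) e)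
     - E e * of_bool (monochromatic (?c p r) e) + E e * of_bool (monochromatic (?c q r) e)
     = (if e = {v, w} then E {v, w} * (1 + of_bool (q = r)) else 0)" if en: "e \<in> edges n" for e
  proof -
    obtain i j where ij: "e = {i, j}" "i \<noteq> j" using en by (rule edgesE)
    then have "e = {v, w}" if "v \<in> e" "w \<in> e" using that vw(3) by auto
    then consider "e = {v, w}" | "v \<notin> e" | "w \<notin> e" by blast
    then show ?thesis
    proof cases
      case 1
      then show ?thesis using pqr vw(3) by (simp add: algebra_simps)
    next
      case 2
      then have "e \<noteq> {v, w}" by blast
      then show ?thesis
        using monochromatic_upd[OF 2] by (simp add: fun_upd_twist[OF vw(3)] del: fun_upd_apply)
    next
      case 3
      then have "e \<noteq> {v, w}" by blast
      then show ?thesis using monochromatic_upd[OF 3] by (simp del: fun_upd_apply)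
    qed
  qed
  have r: "R u * of_bool (first_of_colour (?c p p) u) - R u * of_bool (first_of_colour (?c q p) u)
     - R u * of_bool (first_of_colour (?c p r) u) + R u * of_bool (first_of_colour (?c q r) u) = 0"
    for u
  proof -
    let ?F = "\<lambda>a b. first_of_colour (?c a b) u"
    have v: "?F a d = ?F b d" if "u \<noteq> v"
      "v < u \<Longrightarrow> (c(w := d)) u \<in> {a, b} \<Longrightarrow> \<exists>x\<in>{1..<u} - {v}. (c(w := d)) x = (c(w := d)) u" for a b d
      using first_of_colour_upd[OF that(1), of "c(w := d)" a]
        first_of_colour_upd[OF that(1), of "c(w := d)" b] that(2)
      by (auto simp: fun_upd_twist[OF vw(3)] simp del: fun_upd_apply)
    have w: "?F d a = ?F d b" if "u \<noteq> w"
      "w < u \<Longrightarrow> (c(v := d)) u \<in> {a, b} \<Longrightarrow> \<exists>x\<in>{1..<u} - {w}. (c(v := d)) x = (c(v := d)) u" for a b d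
      using first_of_colour_upd[OF that(1), of "c(v := d)" a]
        first_of_colour_upd[OF that(1), of "c(v := d)" b] that(2)
      by (auto simp del: fun_upd_apply)
    have x1: "x \<in> {1..<u} - {v} \<and> x \<in> {1..<u} - {w}" if "x < u" using that x by simp
    have y1: "y \<in> {1..<u} - {v} \<and> y \<in> {1..<u} - {w} \<and> c y = q \<and> y \<noteq> v \<and> y \<noteq> w" if "q = r" "y < u" using that alt by auto
    consider "u = v" | "u = w" | "u \<noteq> v" "u \<noteq> w" by blast
    \<comment> \<open>Either moving \<open>v\<close> has no effect on the status of
      \<open>u\<close>, or moving \<open>w\<close> has none; both make the mixed difference of the
      term vanish.\<close>
    then have "?F p p = ?F q p \<and> ?F p r = ?F q r \<or> ?F p p = ?F p r \<and> ?F q p = ?F q r"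
    proof cases
      case 1
      have "?F p p = ?F p r" by (rule w) (use 1 vw(3) pqr x x1 alt in \<open>auto intro!: bexI[of _ x]\<close>)
      moreover have "?F q p = ?F q r"
        by (rule w) (use 1 vw(3) pqr y1 alt in \<open>auto intro!: bexI[of _ y]\<close>)
      ultimately show ?thesis by blast
    next
      case 2
      have "?F p p = ?F q p" by (rule v) (use 2 vw(3) pqr x x1 alt in \<open>auto intro!: bexI[of _ x]\<close>)
      moreover have "?F p r = ?F q r"
        by (rule v) (use 2 vw(3) pqr y1 alt in \<open>auto intro!: bexI[of _ y]\<close>)
      ultimately show ?thesis by blast
    next
      case 3
      have V: "?F p d = ?F q d" if vu: "v < u \<Longrightarrow> c u = p \<Longrightarrow> x < u"
         "v < u \<Longrightarrow> c u = q \<Longrightarrow> q = r \<and> y < u" for d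
      proof (rule v[OF 3(1)])
        assume "v < u" and "(c(w := d)) u \<in> {p, q}"
        then have "c u = p \<or> c u = q" "v < u" using 3 by simp_all
        then have "c u = p \<and> x < u \<or> c u = q \<and> q = r \<and> y < u" using vu by blast
        then show "\<exists>x\<in>{1..<u} - {v}. (c(w := d)) x = (c(w := d)) u"
          using x x1 y1 3(2) by (elim disjE conjE; metis fun_upd_other)
      qed
      have W: "?F d p = ?F d r" if "w < u \<Longrightarrow> c u = p \<Longrightarrow> x < u" "c u \<noteq> r" for d
      proof (rule w[OF 3(2)])
        assume "w < u" and "(c(v := d)) u \<in> {p, r}"
        then have "c u = p" using that(2) 3(1) by simp
        then have "x < u" using that(1) \<open>w < u\<close> by blast
        then show "\<exists>x\<in>{1..<u} - {w}. (c(v := d)) x = (c(v := d)) u"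
          using x x1 3(1) \<open>c u = p\<close> by (metis fun_upd_other)
      qed
      \<comment> \<open>Let \<open>q \<noteq> r\<close> and \<open>x < v\<close>. If
        \<open>u\<close> has colour \<open>q\<close>, then \<open>w\<close> never enters its class;
        otherwise \<open>v\<close> can enter it only through colour \<open>p\<close>, where
        \<open>x\<close> comes earlier anyway. The case \<open>x < w\<close> is symmetric.\<close>
      from alt consider "q \<noteq> r" "x < v" "c u = q" | "q \<noteq> r" "x < v" "c u \<noteq> q"
        | "q \<noteq> r" "x < w" "c u = r" | "q \<noteq> r" "x < w" "c u \<noteq> r" | "q = r" "x < v" "y < v" by blast
      then show ?thesis
        by cases (use V[of p] V[of r] W[of p] W[of q] pqr in simp_all)
    qed
    then have "of_bool (first_of_colour (?c p p) u) - of_bool (first_of_colour (?c q p) u)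
     - of_bool (first_of_colour (?c p r) u) + of_bool (first_of_colour (?c q r) u) = (0 :: real)"
      by auto
    then show ?thesis by (simp flip: right_diff_distrib distrib_left)
  qed
  have "(\<Sum>e\<in>edges n. (if e = {v, w} then E {v, w} * (1 + of_bool (q = r)) else 0))
     = E {v, w} * (1 + of_bool (q = r))"
    using vw by (simp add: finite_edges edges_pairI)
  then have se: "(\<Sum>e\<in>edges n. E e * of_bool (monochromatic (?c p p) e) - E e * of_bool (monochromatic (?c q p) e)
     - E e * of_bool (monochromatic (?c p r) e) + E e * of_bool (monochromatic (?c q r) e))
     = E {v, w} * (1 + of_bool (q = r))" using e by (simp cong: sum.cong)
  have sr: "(\<Sum>u\<in>{4..n}. R u * of_bool (first_of_colour (?c p p) u) - R u * of_bool (first_of_colour (?c q p) u)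
     - R u * of_bool (first_of_colour (?c p r) u) + R u * of_bool (first_of_colour (?c q r) u)) = 0"
    using r by (simp only: sum.neutral_const)
  show ?thesis
    using se sr unfolding weight_def sum.distrib sum_subtractf by linarith
qed

text \<open>Both target classes contain a vertex before \<open>v\<close>, so no vertex gains or
  loses the status of representative. Only edges at \<open>v\<close> contribute, and all but two of
  them have coefficient zero.\<close>

lemma weight_single_move:
  assumes v: "v \<in> {1..n}" and a: "a \<in> {1..n}" "a < v" "c a = p" and b: "b \<in> {1..n}" "b < v" "c b = q"
    and pq: "p \<noteq> q" and zero: "\<And>u. u \<in> {1..n} \<Longrightarrow> u \<notin> {v, a, b} \<Longrightarrow> E {v, u} = 0"
  shows "weight n E R (c(v := p)) - weight n E R (c(v := q)) = E {v, a} - E {v, b}"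
proof -
  have ab: "a \<noteq> b" using a b pq by auto
  have e: "E e * of_bool (monochromatic (c(v := p)) e) - E e * of_bool (monochromatic (c(v := q)) e)
     = (if e = {v, a} then E {v, a} else 0) - (if e = {v, b} then E {v, b} else 0)" if en: "e \<in> edges n" for e
  proof -
    obtain i j where ij: "e = {i, j}" "i \<in> {1..n}" "j \<in> {1..n}" "i \<noteq> j" using en by (rule edgesE)
    have *: ?thesis if "e = {v, u}" "u \<noteq> v" "u \<in> {1..n}" for u
    proof -
      have "{v, u} = {v, a} \<longleftrightarrow> u = a" "{v, u} = {v, b} \<longleftrightarrow> u = b" by (auto simp: doubleton_eq_iff)
      moreover have "E {v, u} = 0" if "u \<noteq> a" "u \<noteq> b" using zero[of u] that \<open>u \<noteq> v\<close> \<open>u \<in> _\<close> by blast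
      ultimately show ?thesis
        using that(2) a(3) b(3) ab pq unfolding that(1) by (cases "u = a"; cases "u = b") simp_all
    qed
    consider "v = i" | "v = j" | "v \<notin> e" using ij(1) by blast
    then show ?thesis
    proof cases
      case 1
      then show ?thesis using *[of j] ij by blast
    next
      case 2
      then show ?thesis using *[of i] ij by (metis insert_commute)
    next
      case 3
      then have "e \<noteq> {v, a}" "e \<noteq> {v, b}" by blast+
      then show ?thesis using monochromatic_upd[OF 3] by simp
    qed
  qed
  have r: "first_of_colour (c(v := p)) u = first_of_colour (c(v := q)) u" for u
  proof -
    have "a \<in> {1..<u}" if "a < u" using that a by simp
    moreover have "b \<in> {1..<u}" if "b < u" using that b by simp
    ultimately show ?thesis
      using a b by (cases "u = v"; cases "v < u"; force simp: first_of_colour_def)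
  qed
  have "(\<Sum>e\<in>edges n. (if e = {v, a} then E {v, a} else 0) - (if e = {v, b} then E {v, b} else 0))
     = E {v, a} - E {v, b}"
    using v a b by (simp add: finite_edges edges_pairI sum_subtractf)
  then have "(\<Sum>e\<in>edges n. E e * of_bool (monochromatic (c(v := p)) e) - E e * of_bool (monochromatic (c(v := q)) e))
     = E {v, a} - E {v, b}" using e by (simp cong: sum.cong)
  then show ?thesis
    using r unfolding weight_def sum_subtractf by simp
qed

text \<open>The analogue of \<open>first_of_colour_upd\<close> for two moved vertices; again the
  right-hand side is free of the target colours.\<close>

lemma first_of_colour_upd2:
  assumes "u \<noteq> v" "u \<noteq> w" "v \<noteq> w"
    and "p = c u \<Longrightarrow> \<exists>z\<in>{1..<u} - {v, w}. c z = c u"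
    and "q = c u \<Longrightarrow> \<exists>z\<in>{1..<u} - {v, w}. c z = c u"
  shows "first_of_colour (c(v := p, w := q)) u \<longleftrightarrow> (\<forall>z\<in>{1..<u} - {v, w}. c z \<noteq> c u)"
proof
  assume f: "first_of_colour (c(v := p, w := q)) u"
  show "\<forall>z\<in>{1..<u} - {v, w}. c z \<noteq> c u"
  proof
    fix z assume z: "z \<in> {1..<u} - {v, w}"
    then have "(c(v := p, w := q)) z \<noteq> (c(v := p, w := q)) u"
      using f unfolding first_of_colour_def by blast
    then show "c z \<noteq> c u" using z assms(1,2) by simp
  qed
next
  assume *: "\<forall>z\<in>{1..<u} - {v, w}. c z \<noteq> c u"
  have p: "p \<noteq> c u"
    by (rule notI, drule assms(4), use * in blast)
  have q: "q \<noteq> c u"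
    by (rule notI, drule assms(5), use * in blast)
  show "first_of_colour (c(v := p, w := q)) u"
    unfolding first_of_colour_def
  proof
    fix z assume "z \<in> {1..<u}"
    then show "(c(v := p, w := q)) z \<noteq> (c(v := p, w := q)) u"
      using bspec[OF *, of z] p q assms(1-3) by auto
  qed
qed

section \<open>Counting representatives\<close>

text \<open>Every colour in use has exactly one first vertex, so \<open>c\<close> is a bijection
  from first vertices to colours.\<close>

lemma card_first_of_colour: "card {u \<in> {1..n}. first_of_colour c u} = card (c ` {1..n})"
proof -
  have "inj_on c {u \<in> {1..n}. first_of_colour c u}"
    by (rule linorder_inj_onI') (auto simp: first_of_colour_def)
  moreover have "c ` {u \<in> {1..n}. first_of_colour c u} = c ` {1..n}"
  proof (rule equalityI; rule subsetI)
    fix k assume "k \<in> c ` {1..n}"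
    then obtain j where j: "j \<in> {1..n}" "c j = k" by blast
    define i where "i = (LEAST i. 1 \<le> i \<and> c i = k)"
    have i: "1 \<le> i \<and> c i = k" unfolding i_def by (rule LeastI[of _ j]) (use j in simp)
    have "i \<le> j" unfolding i_def by (rule Least_le) (use j in simp)
    moreover have "c v \<noteq> k" if "1 \<le> v" "v < i" for v
      using not_less_Least[of v "\<lambda>i. 1 \<le> i \<and> c i = k"] that unfolding i_def by blast
    ultimately have "i \<in> {u \<in> {1..n}. first_of_colour c u}"
      using i j by (auto simp: first_of_colour_def)
    then show "k \<in> c ` {u \<in> {1..n}. first_of_colour c u}" using i by blast
  qed auto
  ultimately show ?thesis using card_image by fastforce
qed

text \<open>This is the identity of the overview for colourings. Among 1, 2, 3 each equal pair costs
  one representative, except that the three pairs of a common class cost only two.\<close>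

lemma sum_first_of_colour:
  assumes "3 \<le> n"
  shows "(\<Sum>u\<in>{4..n}. of_bool (first_of_colour c u)) = real (card (c ` {1..n})) - 3
    + of_bool (c 1 = c 2) + of_bool (c 1 = c 3) + of_bool (c 2 = c 3) - of_bool (c 1 = c 2 \<and> c 2 = c 3)"
proof -
  have eq: "{1..n} = {1, 2, 3} \<union> {4..n}" using assms by auto
  have "(\<Sum>u\<in>{1..n}. of_bool (first_of_colour c u)) = (\<Sum>u\<in>{1, 2, 3}. of_bool (first_of_colour c u))
     + (\<Sum>u\<in>{4..n}. of_bool (first_of_colour c u) :: real)"
    unfolding eq by (rule sum.union_disjoint) auto
  moreover have "(\<Sum>u\<in>{1..n}. of_bool (first_of_colour c u) :: real) = card {u \<in> {1..n}. first_of_colour c u}"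
    by (simp add: of_bool_def sum.If_cases Int_def)
  moreover have "{1..<2} = {1::nat}" "{1..<3} = {1, 2::nat}" by auto
  then have "(\<Sum>u\<in>{1, 2, 3}. of_bool (first_of_colour c u)) = 3
     - of_bool (c 1 = c 2) - of_bool (c 1 = c 3) - of_bool (c 2 = c 3)
     + (of_bool (c 1 = c 2 \<and> c 2 = c 3) :: real)"
    by (auto simp: first_of_colour_def)
  ultimately show ?thesis using card_first_of_colour[of n c] by simp
qed

section \<open>Linear forms that are constant on the face\<close>

text \<open>For \<open>t1 < t2 < s\<close> these are the colourings that make the inequality tight:
  a vertex \<open>s\<close> sharing a colour with \<open>t1\<close> or \<open>t2\<close> is not
  first, and the edge terms then add up to 1; otherwise only the term of \<open>s\<close> can supply
  the 1.\<close>

definition face_colouring :: "nat \<Rightarrow> nat \<Rightarrow> nat \<Rightarrow> (nat \<Rightarrow> nat) \<Rightarrow> bool" where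
  "face_colouring s t1 t2 c \<longleftrightarrow>
     c s = c t1 \<or> c s = c t2 \<or> first_of_colour c s \<and> c t1 \<noteq> c t2"

text \<open>A linear form with one value \<open>b\<close> at all tight colourings with
  \<open>K\<close> colours. The normalisation enters later, as the premise
  \<open>E {s, t1} = 0\<close>, when the edges inside \<open>{s, t1, t2}\<close> are
  treated.\<close>

locale constant_weight_on_face =
  fixes n K s t1 t2 :: nat and E :: "nat set \<Rightarrow> real" and R :: "nat \<Rightarrow> real" and b :: real
  assumes K: "3 \<le> K" "K + 2 \<le> n"
    and V: "1 \<le> t1" "t1 < t2" "t2 < s" "3 < s" "s \<le> n"
    and const: "\<And>c. card (c ` {1..n}) = K \<Longrightarrow> face_colouring s t1 t2 c \<Longrightarrow> weight n E R c = b"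
begin

abbreviation "face \<equiv> face_colouring s t1 t2"

section \<open>Colourings with prescribed values\<close>

text \<open>\<open>U\<close> holds the vertices to be moved afterwards, so the \<open>k\<close>
  colours are counted without them; \<open>B\<close> holds the vertices whose colours matter. The
  numerical bound says that the remaining vertices can supply the missing \<open>k - m\<close>
  colours.\<close>

lemma ex_colouring:
  fixes c0 :: "nat \<Rightarrow> nat"
  assumes U: "U \<subseteq> {1..n}" and B: "B \<subseteq> {1..n} - U" and less: "\<And>i. c0 i < m" and m: "card (c0 ` B) = m"
    and k: "m \<le> k" "k + card B + card U \<le> m + n"
  obtains c where "card (c ` ({1..n} - U)) = k" "\<And>i. i \<in> B \<Longrightarrow> c i = c0 i"
    "\<And>i j. i \<in> {1..n} - U \<Longrightarrow> j \<in> {1..n} - U \<Longrightarrow> c0 i \<noteq> c0 j \<Longrightarrow> c i \<noteq> c j"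
proof -
  have fU: "finite U" using U by (rule finite_subset) simp
  have fB: "finite B" using B by (rule finite_subset) simp
  have cU: "card ({1..n} - U) = n - card U" using U fU by (simp add: card_Diff_subset)
  then have "card ({1..n} - U - B) = n - card U - card B"
    using B fB by (simp add: card_Diff_subset)
  moreover have "card B \<le> card ({1..n} - U)" using B by (simp add: card_mono)
  ultimately have le: "k \<le> card (c0 ` B) + card ({1..n} - U - B)"
    using k m cU by linarith
  have "c0 ` B = {..<m}"
    by (rule card_subset_eq) (use less m in auto)
  then have "c0 ` ({1..n} - U) \<subseteq> c0 ` B" using less by auto
  then show ?thesis
    using refine_colouring[OF _ B _ _ le] k m that by (metis finite_Diff finite_atLeastAtMost)
qed

lemma image_fun_upd1:
  assumes "v \<in> {1..n}" "p \<in> c ` ({1..n} - {v})"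
  shows "(c(v := p)) ` {1..n} = c ` ({1..n} - {v})"
  using assms by (simp only: fun_upd_image if_True insert_absorb)

lemma image_fun_upd2:
  assumes "v \<in> {1..n}" "w \<in> {1..n}" "v \<noteq> w"
  shows "(c(v := p, w := q)) ` {1..n} = insert q (insert p (c ` ({1..n} - {v, w})))"
proof -
  have "{1..n} - {w} - {v} = {1..n} - {v, w}" "v \<in> {1..n} - {w}" using assms by blast+
  then show ?thesis using assms by (simp only: fun_upd_image if_True)
qed

section \<open>Vanishing of edge coefficients\<close>

text \<open>All \<open>K\<close> colours occur outside \<open>{v, w}\<close> and the moved vertices
  only take colours present there, so the four colourings all have weight \<open>b\<close> and the
  mixed difference is zero.\<close>

lemma mixed_difference_zero:
  assumes vw: "v \<in> {1..n}" "w \<in> {1..n}" "v \<noteq> w" and c: "card (c ` ({1..n} - {v, w})) = K"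
    and xyz: "x \<in> {1..n} - {v, w}" "y \<in> {1..n} - {v, w}" "z \<in> {1..n} - {v, w}"
    and neq: "c x \<noteq> c y" "c x \<noteq> c z"
    and alt: "c y \<noteq> c z \<and> (x < v \<or> x < w) \<or> y = z \<and> x < v \<and> y < v"
    and face: "\<And>p q. p \<in> {c x, c y} \<Longrightarrow> q \<in> {c x, c z} \<Longrightarrow> face (c(v := p, w := q))"
  shows "E {v, w} = 0"
proof -
  have "weight n E R (c(v := p, w := q)) = b" if "p \<in> {c x, c y}" "q \<in> {c x, c z}" for p q
  proof (rule const)
    show "card ((c(v := p, w := q)) ` {1..n}) = K"
      using image_fun_upd2[OF vw, of c p q] c xyz that by (metis (no_types) imageI insertE insert_absorb singletonD)
  qed (use face that in simp)
  moreover have "weight n E R (c(v := c x, w := c x)) - weight n E R (c(v := c y, w := c x))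
       - weight n E R (c(v := c x, w := c z)) + weight n E R (c(v := c y, w := c z))
       = E {v, w} * (1 + of_bool (c y = c z))"
  proof (rule weight_mixed_difference[where x = x and y = y])
    show "c y \<noteq> c z \<and> (x < v \<or> x < w)
      \<or> c y = c z \<and> x < v \<and> y < v \<and> y \<noteq> w \<and> y \<in> {1..n} \<and> c y = c y"
      using alt xyz(2) by blast
  qed (use vw xyz(1) neq in simp_all)
  ultimately have "E {v, w} * (1 + of_bool (c y = c z)) = 0" by simp
  then show ?thesis by (auto simp: of_bool_def split: if_splits)
qed

text \<open>While \<open>s\<close> and \<open>u\<close> move between the classes of
  \<open>t1\<close> and \<open>t2\<close>, the vertex \<open>s\<close> always shares a colour with
  one of these, so the face is never left.\<close>

lemma edge_s_zero:
  assumes "u \<in> {1..n}" "u \<notin> {s, t1, t2}"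
  shows "E {s, u} = 0"
proof -
  let ?c0 = "\<lambda>i. if i = t2 then 1 else 0 :: nat"
  have *: "{s, u} \<subseteq> {1..n}" "{t1, t2} \<subseteq> {1..n} - {s, u}" "card {t1, t2} = 2" "card {s, u} = 2"
    and st: "s \<noteq> u" "t1 \<noteq> u" "t2 \<noteq> u" "t1 < s" "t2 < s" "t1 \<noteq> t2"
    using V assms by auto
  have im: "card (?c0 ` {t1, t2}) = 2" using st by simp
  have kk: "2 \<le> K" "K + card {t1, t2} + card {s, u} \<le> 2 + n" using K * by simp_all
  have less: "?c0 i < 2" for i by simp
  obtain c where c: "card (c ` ({1..n} - {s, u})) = K" "\<And>i. i \<in> {t1, t2} \<Longrightarrow> c i = ?c0 i"
    "\<And>i j. i \<in> {1..n} - {s, u} \<Longrightarrow> j \<in> {1..n} - {s, u} \<Longrightarrow> ?c0 i \<noteq> ?c0 j \<Longrightarrow> c i \<noteq> c j"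
    by (rule ex_colouring[OF *(1,2) less im kk that])
  have cc: "c t1 = 0" "c t2 = 1" using c(2) V by auto
  show ?thesis
  proof (rule mixed_difference_zero[of s u c t1 t2 t2])
    show "face (c(s := p, u := q))" if "p \<in> {c t1, c t2}" "q \<in> {c t1, c t2}" for p q
      using that st by (auto simp: face_colouring_def)
    show "s \<in> {1..n}" "u \<in> {1..n}" "s \<noteq> u" using *(1) st by auto
    show "t1 \<in> {1..n} - {s, u}" "t2 \<in> {1..n} - {s, u}" "t2 \<in> {1..n} - {s, u}" using *(2) by auto
    show "c t1 \<noteq> c t2" "c t1 \<noteq> c t2" using cc by auto
    show "c t2 \<noteq> c t2 \<and> (t1 < s \<or> t1 < u) \<or> t2 = t2 \<and> t1 < s \<and> t2 < s" using st by auto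
  qed (fact c(1))
qed

text \<open>Keep \<open>s\<close> alone in its class and \<open>t1\<close>, \<open>t2\<close> apart;
  then \<open>v\<close> and \<open>w\<close> may move between the classes of two vertices among 1,
  2, 3, both of which come before \<open>v\<close>.\<close>

lemma edge_other_zero:
  assumes v: "v \<in> {4..n}" and w: "w \<in> {1..n}" "w < v" and st: "v \<notin> {s, t1, t2}" "w \<notin> {s, t1, t2}"
  shows "E {v, w} = 0"
proof -
  define x where "x = (if w = 1 then 2 else 1 :: nat)"
  define y where "y = (if w = 3 then 2 else 3 :: nat)"
  have xy: "x \<noteq> y" "x \<noteq> w" "y \<noteq> w" "x < 4" "y < 4" "x \<in> {1..n}" "y \<in> {1..n}" "x \<noteq> s" "y \<noteq> s"
    using V by (auto simp: x_def y_def)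
  \<comment> \<open>Colour 2 is reserved for \<open>s\<close>. The remaining branches separate
    \<open>x\<close> from \<open>y\<close> as well as \<open>t1\<close> from \<open>t2\<close>, also
    when these pairs overlap.\<close>
  define c0 where "c0 = (\<lambda>i. if i = s then 2 else if i = t1 then 0 else if i = t2 then 1
     else if i = x then (if y = t1 then 1 else 0) else if x = t2 then 0 else 1 :: nat)"
  have *: "{v, w} \<subseteq> {1..n}" "{s, t1, t2} \<subseteq> {1..n} - {v, w}" "card {s, t1, t2} = 3" "card {v, w} = 2"
    using V v w st by auto
  have im: "card (c0 ` {s, t1, t2}) = 3" using V by (simp add: c0_def)
  have less: "c0 i < 3" for i by (simp add: c0_def)
  have xy0: "c0 x \<noteq> c0 y" "c0 x \<noteq> 2" "c0 y \<noteq> 2" using xy V by (auto simp: c0_def)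
  have s0: "c0 i = 2 \<longleftrightarrow> i = s" for i by (simp add: c0_def)
  have t0: "c0 t1 \<noteq> c0 t2" using V by (auto simp: c0_def)
  have kk: "3 \<le> K" "K + card {s, t1, t2} + card {v, w} \<le> 3 + n" using K * by simp_all
  obtain c where c: "card (c ` ({1..n} - {v, w})) = K" "\<And>i. i \<in> {s, t1, t2} \<Longrightarrow> c i = c0 i"
    "\<And>i j. i \<in> {1..n} - {v, w} \<Longrightarrow> j \<in> {1..n} - {v, w} \<Longrightarrow> c0 i \<noteq> c0 j \<Longrightarrow> c i \<noteq> c j"
    by (rule ex_colouring[OF *(1,2) less im kk that])
  have sne: "c i \<noteq> c s" if "i \<in> {1..n} - {v, w}" "i \<noteq> s" for i
    by (rule c(3)) (use that *(2) s0[of i] s0[of s] in auto)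
  have tne: "c t1 \<noteq> c t2" by (rule c(3)) (use *(2) t0 in auto)
  have xyV: "x \<in> {1..n} - {v, w}" "y \<in> {1..n} - {v, w}" using xy v by auto
  show ?thesis
  proof (rule mixed_difference_zero[of v w c x y y])
    show "c x \<noteq> c y" by (rule c(3)[OF xyV xy0(1)])
    then show "c x \<noteq> c y" .
    show "face (c(v := p, w := q))" if "p \<in> {c x, c y}" "q \<in> {c x, c y}" for p q
    proof -
      have "p \<noteq> c s" "q \<noteq> c s" using sne[OF xyV(1) xy(8)] sne[OF xyV(2) xy(9)] that by auto
      then have "(c(v := p, w := q)) i \<noteq> c s" if "i \<in> {1..<s}" for i
        using sne[of i] that V(5) by auto
      then have "first_of_colour (c(v := p, w := q)) s" using st by (simp add: first_of_colour_def)
      then show ?thesis using tne st by (simp add: face_colouring_def)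
    qed
    show "v \<in> {1..n}" "w \<in> {1..n}" "v \<noteq> w" using v w by auto
    show "x \<in> {1..n} - {v, w}" "y \<in> {1..n} - {v, w}" "y \<in> {1..n} - {v, w}" by (fact xyV)+
    show "c y \<noteq> c y \<and> (x < v \<or> x < w) \<or> y = y \<and> x < v \<and> y < v" using xy v by auto
  qed (fact c(1))
qed

text \<open>\<open>t\<close> moves between the classes of \<open>s\<close> and of some
  \<open>x \<le> 3\<close>, and \<open>u\<close> between those of \<open>x\<close> and
  \<open>t'\<close>. Either \<open>t\<close> is with \<open>s\<close>, or \<open>s\<close> is alone
  and \<open>t\<close>, \<open>t'\<close> are apart; both situations are tight.\<close>

lemma edge_t_zero:
  assumes t: "(t, t') \<in> {(t1, t2), (t2, t1)}" and u: "u \<in> {1..n}" "u \<notin> {s, t1, t2}"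
    and ge: "4 \<le> t \<or> 4 \<le> u"
  shows "E {t, u} = 0"
proof -
  \<comment> \<open>Since \<open>t\<close> or \<open>u\<close> is at least 4, at most two of the
    three vertices are among 1, 2, 3, which leaves one for \<open>x\<close>.\<close>
  have "card ({t, u, t'} \<inter> {1..3}) \<le> card ({min t u, t'})" 
    by (rule card_mono) (use ge in auto)
  also have "\<dots> < card {1..3::nat}" by (cases "min t u = t'") auto
  finally have "{t, u, t'} \<inter> {1..3} \<noteq> {1..3}" by auto
  then obtain x where x: "x \<in> {1..3}" "x \<noteq> t" "x \<noteq> u" "x \<noteq> t'" by blast
  define c0 where "c0 = (\<lambda>i. if i = s then 2 else if i = t' then 1 else 0 :: nat)"
  have st: "t < s" "t' < s" "t \<noteq> t'" and tt: "1 \<le> t" "1 \<le> t'" "u \<noteq> t" "u \<noteq> t'" "u \<noteq> s" and "x < s"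
    using V t u x(1) by auto
  have *: "{t, u} \<subseteq> {1..n}" "{s, t', x} \<subseteq> {1..n} - {t, u}" "card {s, t', x} = 3" "card {t, u} = 2"
    using V(5) u(1) x \<open>x < s\<close> st tt by auto
  have im: "card (c0 ` {s, t', x}) = 3" using st x V by (simp add: c0_def)
  have less: "c0 i < 3" for i by (simp add: c0_def)
  have kk: "3 \<le> K" "K + card {s, t', x} + card {t, u} \<le> 3 + n" using K * by simp_all
  obtain c where c: "card (c ` ({1..n} - {t, u})) = K"  "\<And>i. i \<in> {s, t', x} \<Longrightarrow> c i = c0 i"
    "\<And>i j. i \<in> {1..n} - {t, u} \<Longrightarrow> j \<in> {1..n} - {t, u} \<Longrightarrow> c0 i \<noteq> c0 j \<Longrightarrow> c i \<noteq> c j"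
    by (rule ex_colouring[OF *(1,2) less im kk that])
  have s0: "c0 i \<noteq> c0 s" if "i \<noteq> s" for i using that by (simp add: c0_def)
  have sne: "c i \<noteq> c s" if "i \<in> {1..n} - {t, u}" "i \<noteq> s" for i
    by (rule c(3)[OF that(1) _ s0[OF that(2)]]) (use *(2) in simp)
  have cc: "c s = 2" "c t' = 1" "c x = 0" using c(2) st x V by (auto simp: c0_def)
  show ?thesis
  proof (rule mixed_difference_zero[of t u c x s t'])
    show "face (c(t := p, u := q))" if "p \<in> {c x, c s}" "q \<in> {c x, c t'}" for p q
    proof (cases "p = c s")
      case True
      then show ?thesis using t u st by (auto simp: face_colouring_def)
    next
      case False
      then have p: "p = c x" using that by simp
      have "(c(t := p, u := q)) i \<noteq> c s" if "i \<in> {1..<s}" for i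
        using sne[of i] that V(5) \<open>q \<in> _\<close> p cc by auto
      then have "first_of_colour (c(t := p, u := q)) s" using st u by (simp add: first_of_colour_def)
      then show ?thesis using t u p cc st by (auto simp: face_colouring_def)
    qed
    show "t \<in> {1..n}" "u \<in> {1..n}" "t \<noteq> u" using * t u by auto
    show "x \<in> {1..n} - {t, u}" "s \<in> {1..n} - {t, u}" "t' \<in> {1..n} - {t, u}" using * by auto
    show "c s \<noteq> c t' \<and> (x < t \<or> x < u) \<or> s = t' \<and> x < t \<and> s < t" using cc ge x(1) by auto
    show "c x \<noteq> c s" "c x \<noteq> c t'" using cc by auto
  qed (fact c(1))
qed

text \<open>Moving \<open>s\<close> from the class of \<open>t1\<close> to that of \<open>t2\<close>
  stays in the face, and the other edges at \<open>s\<close> are gone by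
  \<open>edge_s_zero\<close>.\<close>

lemma edges_s_t_eq: "E {s, t1} = E {s, t2}"
proof -
  let ?c0 = "\<lambda>i. if i = t2 then 1 else 0 :: nat"
  have *: "{s} \<subseteq> {1..n}" "{t1, t2} \<subseteq> {1..n} - {s}" "card {t1, t2} = 2"
    and im: "card (?c0 ` {t1, t2}) = 2"
    using V by auto
  have kk: "2 \<le> K" "K + card {t1, t2} + card {s} \<le> 2 + n" using K * by simp_all
  have less: "?c0 i < 2" for i by simp
  obtain c where c: "card (c ` ({1..n} - {s})) = K" "\<And>i. i \<in> {t1, t2} \<Longrightarrow> c i = ?c0 i"
    "\<And>i j. i \<in> {1..n} - {s} \<Longrightarrow> j \<in> {1..n} - {s} \<Longrightarrow> ?c0 i \<noteq> ?c0 j \<Longrightarrow> c i \<noteq> c j"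
    by (rule ex_colouring[OF *(1,2) less im kk that])
  have cc: "c t1 = 0" "c t2 = 1" using c(2) V by auto
  have w: "weight n E R (c(s := c t)) = b" if "t \<in> {t1, t2}" for t
  proof (rule const)
    have "(c(s := c t)) ` {1..n} = c ` ({1..n} - {s})"
      by (rule image_fun_upd1) (use that V in auto)
    then show "card ((c(s := c t)) ` {1..n}) = K" using c by simp
  qed (use that V in \<open>auto simp: face_colouring_def\<close>)
  have "weight n E R (c(s := c t1)) - weight n E R (c(s := c t2)) = E {s, t1} - E {s, t2}"
    by (rule weight_single_move) (use V cc edge_s_zero in auto)
  then show ?thesis using w[of t1] w[of t2] by simp
qed

text \<open>With \<open>s\<close> and \<open>t1\<close> together, \<open>t2\<close> moves freely. It
  is moved between \<open>t1\<close> and some \<open>x \<le> 2\<close>, where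
  \<open>4 \<le> t2\<close> gives \<open>E {t2, x} = 0\<close>.\<close>

lemma edge_t1_t2_zero:
  assumes "E {s, t1} = 0" "4 \<le> t2"
  shows "E {t2, t1} = 0"
proof -
  define x where "x = (if t1 = 1 then 2 else 1 :: nat)"
  have x: "x \<noteq> t1" "x < t2" "x < s" "1 \<le> x" using assms V by (auto simp: x_def)
  let ?c0 = "\<lambda>i. if i = x then 1 else 0 :: nat"
  have *: "{t2} \<subseteq> {1..n}" "{s, t1, x} \<subseteq> {1..n} - {t2}" "card {s, t1, x} = 3"
    and im: "card (?c0 ` {s, t1, x}) = 2" using V x by auto
  have kk: "2 \<le> K" "K + card {s, t1, x} + card {t2} \<le> 2 + n" using K * by simp_all
  have less: "?c0 i < 2" for i by simp
  obtain c where c: "card (c ` ({1..n} - {t2})) = K" "\<And>i. i \<in> {s, t1, x} \<Longrightarrow> c i = ?c0 i"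
    "\<And>i j. i \<in> {1..n} - {t2} \<Longrightarrow> j \<in> {1..n} - {t2} \<Longrightarrow> ?c0 i \<noteq> ?c0 j \<Longrightarrow> c i \<noteq> c j"
    by (rule ex_colouring[OF *(1,2) less im kk that])
  have cc: "c t1 = 0" "c x = 1" "c s = 0" using c(2) x V by auto
  have w: "weight n E R (c(t2 := c t)) = b" if "t \<in> {t1, x}" for t
  proof (rule const)
    have "(c(t2 := c t)) ` {1..n} = c ` ({1..n} - {t2})"
      by (rule image_fun_upd1) (use that *(1,2) in auto)
    then show "card ((c(t2 := c t)) ` {1..n}) = K" using c by simp
    show "face (c(t2 := c t))" using V cc by (simp add: face_colouring_def)
  qed
  have "weight n E R (c(t2 := c t1)) - weight n E R (c(t2 := c x)) = E {t2, t1} - E {t2, x}"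
  proof (rule weight_single_move)
    show "E {t2, u} = 0" if "u \<in> {1..n}" "u \<notin> {t2, t1, x}" for u
    proof (cases "u = s")
      case True
      then show ?thesis using edges_s_t_eq assms by (simp add: insert_commute)
    next
      case False
      then show ?thesis using edge_t_zero[of t2 t1 u] that assms by simp
    qed
  qed (use V x cc in auto)
  moreover have "E {t2, x} = 0" using edge_t_zero[of t2 t1 x] assms x V by simp
  ultimately show ?thesis using w[of t1] w[of x] by simp
qed

lemma edges_zero:
  assumes "E {s, t1} = 0" "v \<in> {4..n}" "w \<in> {1..n}" "w < v"
  shows "E {v, w} = 0"
proof -
  have st: "E {s, t1} = 0" "E {s, t2} = 0" using assms(1) edges_s_t_eq by auto
  have com: "E {v, w} = E {w, v}" by (simp add: insert_commute)
  have V': "t1 \<noteq> t2" "t1 \<noteq> s" "t2 \<noteq> s" "\<not> t2 < t1" "v \<noteq> w" "v \<in> {1..n}" using V(2,3) assms by auto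
  consider "v = s" | "w = s" | "{v, w} \<subseteq> {t1, t2}"
    | t t' where "(t, t') \<in> {(t1, t2), (t2, t1)}" "v = t" "w \<notin> {s, t1, t2}"
    | t t' where "(t, t') \<in> {(t1, t2), (t2, t1)}" "w = t" "v \<notin> {s, t1, t2}"
    | "v \<notin> {s, t1, t2}" "w \<notin> {s, t1, t2}" by blast
  then show ?thesis
  proof cases
    case 1
    then show ?thesis using edge_s_zero[of w] st assms(3) V' by blast
  next
    case 2
    then show ?thesis using edge_s_zero[of v] st V' com by auto
  next
    case 3
    then have "v = t2" "w = t1" using assms(4) V(2) by auto
    then show ?thesis using edge_t1_t2_zero assms by auto
  next
    case 4
    then show ?thesis using edge_t_zero[OF 4(1), of w] assms by auto
  next
    case 5
    then show ?thesis using edge_t_zero[OF 5(1), of v] assms V' com by auto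
  next
    case 6
    then show ?thesis using edge_other_zero assms by blast
  qed
qed

lemma weight_low:
  assumes "E {s, t1} = 0"
  shows "weight n E R c = E {1, 2} * of_bool (c 1 = c 2) + E {1, 3} * of_bool (c 1 = c 3)
    + E {2, 3} * of_bool (c 2 = c 3) + (\<Sum>u\<in>{4..n}. R u * of_bool (first_of_colour c u))"
proof -
  let ?L = "{{1, 2}, {1, 3}, {2, 3}} :: nat set set"
  have "(\<Sum>e\<in>edges n. E e * of_bool (monochromatic c e)) = (\<Sum>e\<in>?L. E e * of_bool (monochromatic c e))"
  proof (rule sum.mono_neutral_right)
    show "?L \<subseteq> edges n" using K by (auto intro!: edges_pairI)
    show "\<forall>e\<in>edges n - ?L. E e * of_bool (monochromatic c e) = 0"
    proof
      fix e assume e: "e \<in> edges n - ?L"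
      then have "e \<in> edges n" by blast
      then obtain v w where vw: "e = {v, w}" "v \<in> {1..n}" "w \<in> {1..n}" "w < v"
        by (rule edgesE_max)
      have "v \<in> {4..n}"
      proof (rule ccontr)
        assume "v \<notin> {4..n}"
        then have "v = 2 \<and> w = 1 \<or> v = 3 \<and> w = 1 \<or> v = 3 \<and> w = 2" using vw by auto
        then show False using e vw(1) by (auto simp: insert_commute)
      qed
      then show "E e * of_bool (monochromatic c e) = 0" using edges_zero[OF assms] vw by simp
    qed
  qed (rule finite_edges)
  also have "\<dots> = E {1, 2} * of_bool (c 1 = c 2) + E {1, 3} * of_bool (c 1 = c 3) + E {2, 3} * of_bool (c 2 = c 3)"
    by (simp add: doubleton_eq_iff)
  finally show ?thesis by (simp add: weight_def)
qed

section \<open>Equality of representative coefficients\<close>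

text \<open>First \<open>s\<close> owns the new colour \<open>N\<close> and \<open>v\<close> stands
  behind \<open>x\<close>; then \<open>v\<close> is first in colour \<open>N\<close> and
  \<open>s\<close> stands behind \<open>x\<close> or behind \<open>v\<close>. The vertices 1, 2, 3
  keep their colours, so by \<open>weight_low\<close> the two equal weights differ by
  \<open>R s - R v\<close>.\<close>

lemma rep_weight_swap:
  assumes st: "E {s, t1} = 0" and v: "v \<in> {4..n}" "v \<noteq> s"
    and x: "x \<in> {1..3}" and c: "card (c ` ({1..n} - {s, v})) = K - 1"
    and N: "N \<notin> c ` {1..n}" and p: "p = c x \<or> p = N \<and> v < s"
    and face: "face (c(s := N, v := c x))" "face (c(s := p, v := N))"
  shows "R v = R s"
proof -
  let ?c1 = "c(s := N, v := c x)" and ?c2 = "c(s := p, v := N)"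
  have xv: "x < s" "x < v" "1 \<le> x" "x \<le> n" "s \<in> {1..n}" "v \<in> {1..n}" "s \<noteq> v" using x v V(4,5) by auto
  have cx: "c x \<in> c ` ({1..n} - {s, v})" using xv by auto
  have "c ` ({1..n} - {s, v}) \<subseteq> c ` {1..n}" by blast
  then have Nn: "N \<notin> c ` ({1..n} - {s, v})" "c x \<noteq> N" using N cx by auto
  have "card (insert N (c ` ({1..n} - {s, v}))) = K" using Nn(1) c K by simp
  moreover have "?c1 ` {1..n} = insert N (c ` ({1..n} - {s, v}))"
    using image_fun_upd2[OF xv(5-7), of c N "c x"] cx by (simp add: insert_absorb insert_commute)
  moreover have "?c2 ` {1..n} = insert N (c ` ({1..n} - {s, v}))"
    using image_fun_upd2[OF xv(5-7), of c p N] cx p by (auto simp: insert_absorb)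
  ultimately have "weight n E R ?c1 = b" "weight n E R ?c2 = b"
    using const face by simp_all
  moreover have "?c1 1 = ?c2 1" "?c1 2 = ?c2 2" "?c1 3 = ?c2 3" using v V(4) by simp_all
  ultimately have sum: "(\<Sum>u\<in>{4..n}. R u * of_bool (first_of_colour ?c1 u))
      = (\<Sum>u\<in>{4..n}. R u * of_bool (first_of_colour ?c2 u))"
    using weight_low[OF st, of ?c1] weight_low[OF st, of ?c2] by (simp del: fun_upd_apply)
  have Nu: "c u \<noteq> N" if "u \<in> {1..n}" for u using N that by blast
  have 1: "first_of_colour ?c1 u = first_of_colour ?c2 u" if "u \<in> {4..n}" "u \<noteq> s" "u \<noteq> v" for u
  proof -
    have u: "u \<noteq> s" "u \<noteq> v" "s \<noteq> v" "N \<noteq> c u" "x \<in> {1..<u} - {s, v}"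
      using that xv x Nu[of u] by auto
    have ex: "\<exists>z\<in>{1..<u} - {s, v}. c z = c u" if "c x = c u" using u(5) that by blast
    have "\<exists>z\<in>{1..<u} - {s, v}. c z = c u" if "p = c u" by (rule ex) (use that p u(4) in metis)
    moreover have "\<exists>z\<in>{1..<u} - {s, v}. c z = c u" if "N = c u" using that u(4) by simp
    ultimately show ?thesis
      using first_of_colour_upd2[OF u(1-3), of N c "c x"] first_of_colour_upd2[OF u(1-3), of p c N] ex
      by argo
  qed
  have s1: "first_of_colour ?c1 s" and v2: "first_of_colour ?c2 v"
    using Nu xv Nn p V(5) by (auto simp: first_of_colour_def)
  have v1: "\<not> first_of_colour ?c1 v" using xv by (auto simp: first_of_colour_def intro!: bexI[of _ x])
  have s2: "\<not> first_of_colour ?c2 s"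
    using p xv v by (auto simp: first_of_colour_def intro: bexI[of _ x] bexI[of _ v])
  have "R u * of_bool (first_of_colour ?c1 u) - R u * of_bool (first_of_colour ?c2 u)
     = (if u = s then R s else 0) - (if u = v then R v else 0)" if "u \<in> {4..n}" for u
    using 1[OF that] s1 v1 s2 v2 xv(7) by (cases "u = s"; cases "u = v") simp_all
  then have "(\<Sum>u\<in>{4..n}. R u * of_bool (first_of_colour ?c1 u) - R u * of_bool (first_of_colour ?c2 u))
     = (\<Sum>u\<in>{4..n}. (if u = s then R s else 0) - (if u = v then R v else 0))"
    by (rule sum.cong[OF refl])
  then have "0 = R s - R v" using v V(4,5) sum by (simp add: sum_subtractf)
  then show ?thesis by simp
qed

lemma rep_weight_eq:
  assumes st: "E {s, t1} = 0" and v: "v \<in> {4..n}"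
  shows "R v = R s"
proof -
  consider "v = s" | "v \<notin> {s, t1, t2}"
    | t' where "(v, t') \<in> {(t1, t2), (t2, t1)}" by blast
  then show ?thesis
  proof cases
    case 2
    \<comment> \<open>The vertices 1 and \<open>t1\<close> (possibly the same) get one colour, so
      \<open>s\<close> joins \<open>t1\<close> when it joins 1.\<close>
    let ?c0 = "\<lambda>i. if i = t2 then 1 else 0 :: nat"
    have *: "{s, v} \<subseteq> {1..n}" "{1, t1, t2} \<subseteq> {1..n} - {s, v}" "card {s, v} = 2"
      and im: "card (?c0 ` {1, t1, t2}) = 2" and t2: "t2 \<noteq> 1" "t1 \<noteq> t2"
      using V v 2 by auto
    have "card {1, t1, t2} \<le> 3" by (simp add: card_insert_if)
    then have kk: "2 \<le> K - 1" "K - 1 + card {1, t1, t2} + card {s, v} \<le> 2 + n" using K *(3) by linarith+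
    have less: "?c0 i < 2" for i by simp
    obtain c where c: "card (c ` ({1..n} - {s, v})) = K - 1" "\<And>i. i \<in> {1, t1, t2} \<Longrightarrow> c i = ?c0 i"
      "\<And>i j. i \<in> {1..n} - {s, v} \<Longrightarrow> j \<in> {1..n} - {s, v} \<Longrightarrow> ?c0 i \<noteq> ?c0 j \<Longrightarrow> c i \<noteq> c j"
      by (rule ex_colouring[OF *(1,2) less im kk that])
    have cc: "c 1 = 0" "c t1 = 0" "c t2 = 1" using c(2)[of 1] c(2)[of t1] c(2)[of t2] t2 by simp_all
    obtain N where N: "N \<notin> c ` {1..n}" using ex_new_if_finite[of "c ` {1..n}"] by auto
    show ?thesis
    proof (rule rep_weight_swap[OF st v _ _ c(1) N, of 1 "c 1"])
      have "c i \<noteq> N" if "i \<in> {1..n}" for i using N that by blast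
      then have "first_of_colour (c(s := N, v := c 1)) s"
        using 2 V(4,5) by (auto simp: first_of_colour_def)
      then show "face (c(s := N, v := c 1))" using 2 cc by (simp add: face_colouring_def)
      show "face (c(s := c 1, v := N))" using 2 cc V(2,3) by (simp add: face_colouring_def)
    qed (use 2 in simp_all)
  next
    case 3
    define x where "x = (if t' = 1 then 2 else 1 :: nat)"
    have t: "t' < s" "v < s" "v \<noteq> t'" "1 \<le> t'" "t' \<le> n" using 3 V by auto
    have x: "x \<noteq> t'" "x < 4" "1 \<le> x" by (auto simp: x_def)
    let ?c0 = "\<lambda>i. if i = t' then 1 else 0 :: nat"
    have *: "{s, v} \<subseteq> {1..n}" "{x, t'} \<subseteq> {1..n} - {s, v}" "card {s, v} = 2" "card {x, t'} = 2"
      using V(4,5) v t x by auto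
    have im: "card (?c0 ` {x, t'}) = 2" using x(1) by simp
    have kk: "2 \<le> K - 1" "K - 1 + card {x, t'} + card {s, v} \<le> 2 + n" using K *(3,4) by linarith+
    have less: "?c0 i < 2" for i by simp
    obtain c where c: "card (c ` ({1..n} - {s, v})) = K - 1" "\<And>i. i \<in> {x, t'} \<Longrightarrow> c i = ?c0 i"
      "\<And>i j. i \<in> {1..n} - {s, v} \<Longrightarrow> j \<in> {1..n} - {s, v} \<Longrightarrow> ?c0 i \<noteq> ?c0 j \<Longrightarrow> c i \<noteq> c j"
      by (rule ex_colouring[OF *(1,2) less im kk that])
    have cc: "c x = 0" "c t' = 1" using c(2)[of x] c(2)[of t'] x(1) by simp_all
    obtain N where N: "N \<notin> c ` {1..n}" using ex_new_if_finite[of "c ` {1..n}"] by auto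
    have Nn: "c i \<noteq> N" if "i \<in> {1..n}" for i using N that by blast
    show ?thesis
    \<comment> \<open>In the second colouring \<open>s\<close> stays with \<open>v\<close>, which is
      \<open>t1\<close> or \<open>t2\<close>; this makes it tight.\<close>
    proof (rule rep_weight_swap[OF st v _ _ c(1) N, of x N])
      have "c x \<noteq> N" by (rule Nn) (use x v in simp)
      then have "first_of_colour (c(s := N, v := c x)) s"
        using t V(4,5) Nn by (auto simp: first_of_colour_def)
      then show "face (c(s := N, v := c x))" using 3 t cc by (auto simp: face_colouring_def)
      show "face (c(s := N, v := N))" using 3 t by (auto simp: face_colouring_def)
    qed (use t x in simp_all)
  qed simp
qed

section \<open>Traces on \<open>{1, 2, 3}\<close> and the final linear system\<close>

text \<open>The admissible \<open>(a, d)\<close> enumerate the five partitions of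
  \<open>{1, 2, 3}\<close>, with colours numbered by first occurrence.\<close>

lemma ex_face_colouring_pattern:
  assumes cond: "3 < t2 \<or> K + 3 \<le> n" and a: "a \<le> 1" "d \<le> Suc a"
  obtains c where "card (c ` {1..n}) = K" "face c" "c 1 = 0" "c 2 = a" "c 3 = d"
proof (cases "3 < t2")
  case True
  \<comment> \<open>The five vertices 1, 2, 3, \<open>s\<close>, \<open>t2\<close> always show
    exactly three colours, so that \<open>K + 2 \<le> n\<close> suffices. The vertex
    \<open>s\<close> joins \<open>t2\<close>, except when 1, 2, 3 are together: then
    \<open>s\<close> is alone and \<open>t1\<close>, \<open>t2\<close> are apart.\<close>
  define c0 where "c0 = (\<lambda>i. if i = 2 then a else if i = 3 then d
     else if i = s then (if d = 2 then 0 else 2)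
     else if i = t2 then (if a = 0 \<and> d = 0 then 1 else if d = 2 then 0 else 2) else 0)"
  have d: "1 \<noteq> s" "2 \<noteq> s" "3 \<noteq> s" "1 \<noteq> t2" "2 \<noteq> t2" "3 \<noteq> t2" "s \<noteq> t2" using True V(3,4) by auto
  then have c0: "c0 1 = 0" "c0 2 = a" "c0 3 = d" "c0 s = (if d = 2 then 0 else 2)"
    "c0 t2 = (if a = 0 \<and> d = 0 then 1 else if d = 2 then 0 else 2)" by (auto simp: c0_def)
  have ad: "a = 0 \<and> d = 0 \<or> a = 0 \<and> d = 1 \<or> a = 1 \<and> d = 0 \<or> a = 1 \<and> d = 1 \<or> a = 1 \<and> d = 2"
    using a by linarith
  have *: "{} \<subseteq> {1..n}" "{1, 2, 3, s, t2} \<subseteq> {1..n} - {}" "card {1, 2, 3, s, t2} = 5"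
    using V(1-3,5) d K by auto
  have im: "card (c0 ` {1, 2, 3, s, t2}) = 3"
    unfolding image_insert image_empty c0 using ad by (elim disjE) (simp_all add: card_insert_if)
  have less: "c0 i < 3" for i using a by (auto simp: c0_def)
  have kk: "3 \<le> K" "K + card {1, 2, 3, s, t2} + card ({} :: nat set) \<le> 3 + n" using K *(3) by simp_all
  obtain c where c: "card (c ` ({1..n} - {})) = K" "\<And>i. i \<in> {1, 2, 3, s, t2} \<Longrightarrow> c i = c0 i"
    "\<And>i j. i \<in> {1..n} - {} \<Longrightarrow> j \<in> {1..n} - {} \<Longrightarrow> c0 i \<noteq> c0 j \<Longrightarrow> c i \<noteq> c j"
    by (rule ex_colouring[OF *(1,2) less im kk that])
  have "face c"
  proof (cases "a = 0 \<and> d = 0")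
    case True
    have "c0 s = 2" using True d by (auto simp: c0_def)
    moreover have "c0 i \<noteq> 2" if "i \<noteq> s" for i using True d that by (auto simp: c0_def)
    ultimately have "c i \<noteq> c s" if "i \<in> {1..<s}" for i
      by (intro c(3)) (use that V(5) in auto)
    moreover have "c0 t1 \<noteq> c0 t2" using True V(2,3) d by (auto simp: c0_def)
    then have "c t1 \<noteq> c t2" by (intro c(3)) (use *(2) V(1,2) in auto)
    ultimately show ?thesis by (simp add: face_colouring_def first_of_colour_def)
  next
    case False
    then have "c0 s = c0 t2" using c0 by simp
    then show ?thesis using c(2) by (simp add: face_colouring_def)
  qed
  then show ?thesis using that[of c] c(1) c(2)[of 1] c(2)[of 2] c(2)[of 3] c0 by simp
next
  case False
  \<comment> \<open>Now \<open>t1 \<le> 2\<close>, so its colour is part of the trace and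
    \<open>s\<close> is put with it. The four vertices may show a single colour, which is where
    \<open>K + 3 \<le> n\<close> enters.\<close>
  define c0 where "c0 = (\<lambda>i. if i = 2 then a else if i = 3 then d
     else if i = s then (if t1 = 2 then a else 0) else 0)"
  define m where "m = Suc (max a d)"
  have t1: "t1 = 1 \<or> t1 = 2" using False V(1,2) by linarith
  have d: "1 \<noteq> s" "2 \<noteq> s" "3 \<noteq> s" using V(4) by auto
  then have c0: "c0 1 = 0" "c0 2 = a" "c0 3 = d" "c0 s = (if t1 = 2 then a else 0)" by (auto simp: c0_def)
  have ad: "a = 0 \<and> d = 0 \<or> a = 0 \<and> d = 1 \<or> a = 1 \<and> d = 0 \<or> a = 1 \<and> d = 1 \<or> a = 1 \<and> d = 2"
    using a by linarith
  have *: "{} \<subseteq> {1..n}" "{1, 2, 3, s} \<subseteq> {1..n} - {}" "card {1, 2, 3, s} = 4"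
    using V(4,5) d K by auto
  have im: "card (c0 ` {1, 2, 3, s}) = m"
    unfolding image_insert image_empty c0 m_def using ad by (elim disjE) (simp_all add: card_insert_if)
  have less: "c0 i < m" for i by (auto simp: c0_def m_def)
  have kk: "m \<le> K" "K + card {1, 2, 3, s} + card ({} :: nat set) \<le> m + n"
    using K *(3) cond False a by (simp_all add: m_def)
  obtain c where c: "card (c ` ({1..n} - {})) = K" "\<And>i. i \<in> {1, 2, 3, s} \<Longrightarrow> c i = c0 i"
    "\<And>i j. i \<in> {1..n} - {} \<Longrightarrow> j \<in> {1..n} - {} \<Longrightarrow> c0 i \<noteq> c0 j \<Longrightarrow> c i \<noteq> c j"
    by (rule ex_colouring[OF *(1,2) less im kk that])
  have "c s = c t1" using c(2)[of s] c(2)[of t1] t1 c0 by auto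
  then have "face c" by (simp add: face_colouring_def)
  then show ?thesis using that[of c] c(1) c(2)[of 1] c(2)[of 2] c(2)[of 3] c0 by simp
qed

lemma weights_zero:
  assumes st: "E {s, t1} = 0" and cond: "3 < t2 \<or> K + 3 \<le> n"
  shows "e \<in> edges n \<Longrightarrow> E e = 0" "u \<in> {4..n} \<Longrightarrow> R u = 0"
proof -
  define \<alpha> where "\<alpha> = R s"
  have w: "E {1, 2} * of_bool (a = 0) + E {1, 3} * of_bool (d = 0) + E {2, 3} * of_bool (a = d)
     + \<alpha> * (real K - 3 + of_bool (a = 0) + of_bool (d = 0) + of_bool (a = d)
       - of_bool (a = 0 \<and> a = d)) = b"
    if ad: "a \<le> 1" "d \<le> Suc a" for a d
  proof -
    obtain c where c: "card (c ` {1..n}) = K" "face c" "c 1 = 0" "c 2 = a" "c 3 = d"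
      using ex_face_colouring_pattern[OF cond ad] by blast
    have "(\<Sum>u\<in>{4..n}. R u * of_bool (first_of_colour c u)) = (\<Sum>u\<in>{4..n}. \<alpha> * of_bool (first_of_colour c u))"
      by (rule sum.cong) (use rep_weight_eq[OF st] in \<open>auto simp: \<alpha>_def\<close>)
    also have "\<dots> = \<alpha> * (\<Sum>u\<in>{4..n}. of_bool (first_of_colour c u))" by (rule sum_distrib_left[symmetric])
    also have "(\<Sum>u\<in>{4..n}. of_bool (first_of_colour c u)) = real K - 3 + of_bool (0 = a) + of_bool (0 = d)
      + of_bool (a = d) - of_bool (0 = a \<and> a = d)"
      using sum_first_of_colour[of n c] K unfolding c by simp
    finally show ?thesis
      using weight_low[OF st, of c] const[OF c(1,2)] unfolding c by (simp add: eq_commute[of 0])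
  qed
  \<comment> \<open>The trace \<open>(1, 2)\<close> gives \<open>b = \<alpha> * (K - 3)\<close>; the
    three traces with one equal pair then make each edge coefficient \<open>- \<alpha>\<close>, and
    \<open>(0, 0)\<close> leaves \<open>- \<alpha> = 0\<close>.\<close>
  have E: "E {1, 2} = 0" "E {1, 3} = 0" "E {2, 3} = 0" and \<alpha>: "\<alpha> = 0"
    using w[of 1 2] w[of 0 1] w[of 1 0] w[of 1 1] w[of 0 0] by (simp_all add: algebra_simps)
  show "R u = 0" if "u \<in> {4..n}" using rep_weight_eq[OF st that] \<alpha> \<alpha>_def by simp
  show "E e = 0" if e: "e \<in> edges n"
  proof -
    obtain v w where vw: "e = {v, w}" "v \<in> {1..n}" "w \<in> {1..n}" "w < v" using e by (rule edgesE_max)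
    show ?thesis
    proof (cases "v \<in> {4..n}")
      case True
      then show ?thesis using edges_zero[OF st] vw by blast
    next
      case False
      then have "v = 2 \<and> w = 1 \<or> v = 3 \<and> w = 1 \<or> v = 3 \<and> w = 2" using vw by auto
      then show ?thesis using E vw(1) by (auto simp: insert_commute)
    qed
  qed
qed

end

section \<open>The polytope\<close>

text \<open>One construction serves linear forms and points alike, since both are families indexed
  by the coordinate names.\<close>

definition coeff_vec :: "('d::finite \<Rightarrow> coord) \<Rightarrow> (nat set \<Rightarrow> real) \<Rightarrow> (nat \<Rightarrow> real) \<Rightarrow> real ^ 'd" where
  "coeff_vec ix E R = (\<chi> d. case ix d of Edge e \<Rightarrow> E e | Rep u \<Rightarrow> R u)"

definition colour_vec :: "('d::finite \<Rightarrow> coord) \<Rightarrow> (nat \<Rightarrow> nat) \<Rightarrow> real ^ 'd" where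
  "colour_vec ix c = coeff_vec ix (\<lambda>e. of_bool (monochromatic c e)) (\<lambda>u. of_bool (first_of_colour c u))"

text \<open>The premise puts the orthogonal complement of the directions of \<open>T\<close> into a
  line, so these directions span a space of codimension at most 1.\<close>

lemma aff_dim_ge_hyperplane:
  fixes T :: "'a::euclidean_space set"
  assumes x0: "x0 \<in> T" and a: "\<And>a. (\<And>x. x \<in> T \<Longrightarrow> a \<bullet> x = a \<bullet> x0) \<Longrightarrow> a \<in> span {f}"
  shows "aff_dim T \<ge> int DIM('a) - 1"
proof -
  let ?D = "span ((+) (- x0) ` T)"
  let ?O = "{y \<in> UNIV. \<forall>x\<in>?D. orthogonal x y}"
  have "?O \<subseteq> span {f}"
  proof
    fix y assume y: "y \<in> ?O"
    show "y \<in> span {f}"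
    proof (rule a)
      fix x assume "x \<in> T"
      then have "- x0 + x \<in> ?D" by (intro span_base) simp
      then have "orthogonal (- x0 + x) y" using y by blast
      then show "y \<bullet> x = y \<bullet> x0" by (simp add: orthogonal_def inner_diff_right inner_commute)
    qed
  qed
  then have "dim ?O \<le> dim (span {f})" by (rule dim_subset)
  also have "\<dots> \<le> 1" by simp
  finally have "dim ?O \<le> 1" .
  moreover have "dim ?O + dim ?D = dim (UNIV :: 'a set)"
    by (rule dim_subspace_orthogonal_to_vectors) auto
  moreover have "aff_dim T = int (dim ?D)"
    using aff_dim_eq_dim[of x0 T] x0 hull_inc by (metis dim_span)
  ultimately show ?thesis by simp
qed

section \<open>Linear forms and characteristic vectors in coordinates\<close>

context
  fixes ix :: "'d::finite \<Rightarrow> coord" and n :: nat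
  assumes ix: "bij_betw ix UNIV (coords n)"
begin

lemma ix_cases:
  obtains e where "e \<in> edges n" "ix d = Edge e" | u where "u \<in> {4..n}" "ix d = Rep u"
proof -
  have "ix d \<in> coords n" using bij_betwE[OF ix] by blast
  then show ?thesis using that unfolding coords_def by blast
qed

lemma inv_ix: "inv ix (ix d) = d"
  using ix by (simp add: bij_betw_def inv_f_f)

lemma ix_inv: "co \<in> coords n \<Longrightarrow> ix (inv ix co) = co"
  using ix by (auto simp: bij_betw_def f_inv_into_f)

lemma sum_coords:
  "(\<Sum>d\<in>UNIV. f (ix d)) = (\<Sum>e\<in>edges n. f (Edge e)) + (\<Sum>u\<in>{4..n}. f (Rep u))"
proof -
  have "(\<Sum>d\<in>UNIV. f (ix d)) = sum f (coords n)" by (rule sum.reindex_bij_betw[OF ix])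
  also have "\<dots> = sum f (Edge ` edges n) + sum f (Rep ` {4..n})"
    unfolding coords_def by (rule sum.union_disjoint) (auto simp: finite_edges)
  also have "\<dots> = (\<Sum>e\<in>edges n. f (Edge e)) + (\<Sum>u\<in>{4..n}. f (Rep u))"
    by (simp add: sum.reindex inj_on_def)
  finally show ?thesis .
qed

lemma inner_coeff_vec:
  "coeff_vec ix E R \<bullet> x = (\<Sum>e\<in>edges n. E e * entry ix x (Edge e)) + (\<Sum>u\<in>{4..n}. R u * entry ix x (Rep u))"
proof -
  have "coeff_vec ix E R \<bullet> x
      = (\<Sum>d\<in>UNIV. (case ix d of Edge e \<Rightarrow> E e | Rep u \<Rightarrow> R u) * entry ix x (ix d))"
    by (simp add: inner_vec_def coeff_vec_def entry_def inv_ix)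
  then show ?thesis
    using sum_coords[of "\<lambda>co. (case co of Edge e \<Rightarrow> E e | Rep u \<Rightarrow> R u) * entry ix x co"] by simp
qed

lemma entry_coeff_vec:
  "e \<in> edges n \<Longrightarrow> entry ix (coeff_vec ix E R) (Edge e) = E e"
  "u \<in> {4..n} \<Longrightarrow> entry ix (coeff_vec ix E R) (Rep u) = R u"
  by (simp_all add: entry_def coeff_vec_def ix_inv coords_def)

lemma coeff_vec_entry: "coeff_vec ix (\<lambda>e. entry ix a (Edge e)) (\<lambda>u. entry ix a (Rep u)) = a"
proof -
  have "(case ix d of Edge e \<Rightarrow> entry ix a (Edge e) | Rep u \<Rightarrow> entry ix a (Rep u)) = a $ d" for d
    using inv_ix[of d] by (cases "ix d") (simp_all add: entry_def)
  then show ?thesis by (simp add: coeff_vec_def vec_eq_iff)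
qed

lemma inner_colour_vec: "coeff_vec ix E R \<bullet> colour_vec ix c = weight n E R c"
  by (simp add: inner_coeff_vec weight_def colour_vec_def entry_coeff_vec)

lemma inner_colour_vec': "a \<bullet> colour_vec ix c
    = weight n (\<lambda>e. entry ix a (Edge e)) (\<lambda>u. entry ix a (Rep u)) c"
  by (metis coeff_vec_entry inner_colour_vec)

lemma coeff_vec_nonzero:
  assumes "u \<in> {4..n}" "R u \<noteq> 0"
  shows "coeff_vec ix E R \<noteq> 0"
proof
  assume "coeff_vec ix E R = 0"
  then show False using entry_coeff_vec(2)[OF assms(1), of E R] assms(2) by (simp add: entry_def)
qed

text \<open>The names of the colours are left open, so that the lemma serves both for colouring a
  given partition and for the colour classes of a given colouring.\<close>

lemma colour_vec_eq_char_vec: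
  assumes \<pi>: "partition_on {1..n} \<pi>"
    and c: "\<And>i j. i \<in> {1..n} \<Longrightarrow> j \<in> {1..n} \<Longrightarrow> c i = c j \<longleftrightarrow> (\<exists>C\<in>\<pi>. i \<in> C \<and> j \<in> C)"
  shows "char_vec ix \<pi> = colour_vec ix c" "card (c ` {1..n}) = card \<pi>"
proof -
  have sub: "C \<subseteq> {1..n}" and fin: "finite C" and MinC: "Min C \<in> C" "\<And>i. i \<in> C \<Longrightarrow> Min C \<le> i"
    if "C \<in> \<pi>" for C
  proof -
    show sub: "C \<subseteq> {1..n}" using \<pi> that by (auto simp: partition_on_def)
    then show fin: "finite C" by (rule finite_subset) simp
    have "C \<noteq> {}" using \<pi> that by (auto simp: partition_on_def)
    then show "Min C \<in> C" "\<And>i. i \<in> C \<Longrightarrow> Min C \<le> i" using fin by simp_all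
  qed
  have eqC: "C = D" if "C \<in> \<pi>" "D \<in> \<pi>" "i \<in> C" "i \<in> D" for C D i
    using \<pi> that unfolding partition_on_def disjoint_def by blast
  have cover: "\<exists>C\<in>\<pi>. i \<in> C" if "i \<in> {1..n}" for i
    using \<pi> that unfolding partition_on_def by blast
  have same: "c i = c j" if "C \<in> \<pi>" "i \<in> C" "j \<in> C" for C i j
    using c[of i j] that sub by blast
  show "card (c ` {1..n}) = card \<pi>"
  proof -
    have "inj_on (\<lambda>C. c (Min C)) \<pi>"
    proof (rule inj_onI)
      fix C D assume CD: "C \<in> \<pi>" "D \<in> \<pi>" "c (Min C) = c (Min D)"
      then obtain B where "B \<in> \<pi>" "Min C \<in> B" "Min D \<in> B"
        using c[of "Min C" "Min D"] sub MinC(1) by blast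
      then show "C = D" using eqC CD MinC(1) by metis
    qed
    moreover have "c ` {1..n} = (\<lambda>C. c (Min C)) ` \<pi>"
    proof (rule equalityI; rule subsetI)
      fix k assume "k \<in> c ` {1..n}"
      then obtain i where i: "i \<in> {1..n}" "k = c i" by blast
      then obtain C where C: "C \<in> \<pi>" "i \<in> C" using cover by blast
      then have "k = c (Min C)" using same MinC(1) i by blast
      then show "k \<in> (\<lambda>C. c (Min C)) ` \<pi>" using C by blast
    next
      fix k assume "k \<in> (\<lambda>C. c (Min C)) ` \<pi>"
      then show "k \<in> c ` {1..n}" using MinC(1) sub by blast
    qed
    ultimately show ?thesis by (simp add: card_image)
  qed
  have rep: "representative \<pi> u \<longleftrightarrow> first_of_colour c u" if u: "u \<in> {1..n}" for u
  proof
    assume "representative \<pi> u"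
    then obtain C where C: "C \<in> \<pi>" "u = Min C" by (auto simp: representative_def)
    have "c v \<noteq> c u" if v: "v \<in> {1..<u}" for v
    proof
      assume "c v = c u"
      then obtain D where D: "D \<in> \<pi>" "v \<in> D" "u \<in> D" using c[of v u] u v by auto
      then have "v \<in> C" using eqC[of C D u] C MinC(1) by auto
      then show False using MinC(2) C v by force
    qed
    then show "first_of_colour c u" by (simp add: first_of_colour_def)
  next
    assume f: "first_of_colour c u"
    obtain C where C: "C \<in> \<pi>" "u \<in> C" using cover u by blast
    have "c (Min C) = c u" by (rule same[OF C(1) MinC(1)[OF C(1)] C(2)])
    moreover have "Min C \<le> u" by (rule MinC(2)[OF C])
    moreover have "1 \<le> Min C" using sub[OF C(1)] MinC(1)[OF C(1)] by auto
    ultimately have "u = Min C" using f unfolding first_of_colour_def by force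
    then show "representative \<pi> u" using C by (auto simp: representative_def)
  qed
  have edge: "same_cluster \<pi> e \<longleftrightarrow> monochromatic c e" if e: "e \<in> edges n" for e
  proof -
    obtain i j where ij: "e = {i, j}" "i \<in> {1..n}" "j \<in> {1..n}" using e by (rule edgesE)
    then show ?thesis using c[of i j] by (simp add: same_cluster_def)
  qed
  show "char_vec ix \<pi> = colour_vec ix c"
    unfolding vec_eq_iff
  proof
    fix d
    show "char_vec ix \<pi> $ d = colour_vec ix c $ d"
    proof (cases d rule: ix_cases)
      case (1 e)
      then show ?thesis using edge by (simp add: char_vec_def colour_vec_def coeff_vec_def)
    next
      case (2 u)
      then show ?thesis using rep[of u] by (simp add: char_vec_def colour_vec_def coeff_vec_def)
    qed
  qed
qed

lemma char_vecs_eq_colour_vecs: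
  "{char_vec ix \<pi> | \<pi>. K_partition n K \<pi>} = {colour_vec ix c | c. card (c ` {1..n}) = K}"
proof (rule equalityI; rule subsetI)
  fix x assume "x \<in> {char_vec ix \<pi> | \<pi>. K_partition n K \<pi>}"
  then obtain \<pi> where \<pi>: "x = char_vec ix \<pi>" "partition_on {1..n} \<pi>" "card \<pi> = K"
    by (auto simp: K_partition_def)
  \<comment> \<open>The set is the cluster of \<open>i\<close>, so the colour is its
    representative.\<close>
  define c where "c i = Min {j. \<exists>C\<in>\<pi>. i \<in> C \<and> j \<in> C}" for i
  have eqC: "C = D" if "C \<in> \<pi>" "D \<in> \<pi>" "i \<in> C" "i \<in> D" for C D i
    using \<pi>(2) that unfolding partition_on_def disjoint_def by blast
  have c: "c i = Min C" if "C \<in> \<pi>" "i \<in> C" for C i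
  proof -
    have "{j. \<exists>C\<in>\<pi>. i \<in> C \<and> j \<in> C} = C" using eqC that by blast
    then show ?thesis by (simp add: c_def)
  qed
  have "c i = c j \<longleftrightarrow> (\<exists>C\<in>\<pi>. i \<in> C \<and> j \<in> C)" if ij: "i \<in> {1..n}" "j \<in> {1..n}" for i j
  proof -
    obtain C D where CD: "C \<in> \<pi>" "i \<in> C" "D \<in> \<pi>" "j \<in> D"
      using \<pi>(2) ij unfolding partition_on_def by blast
    have Min: "Min B \<in> B" if "B \<in> \<pi>" for B
    proof (rule Min_in)
      have "B \<subseteq> {1..n}" using \<pi>(2) that by (auto simp: partition_on_def)
      then show "finite B" by (rule finite_subset) simp
      show "B \<noteq> {}" using \<pi>(2) that by (auto simp: partition_on_def)
    qed
    have "C = D" if "c i = c j"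
    proof (rule eqC[OF CD(1,3)])
      show "Min C \<in> C" using Min CD by blast
      show "Min C \<in> D" using Min[OF CD(3)] c CD that by metis
    qed
    then show ?thesis using c CD by metis
  qed
  from colour_vec_eq_char_vec[OF \<pi>(2) this] \<pi> show "x \<in> {colour_vec ix c | c. card (c ` {1..n}) = K}"
    by auto
next
  fix x assume "x \<in> {colour_vec ix c | c. card (c ` {1..n}) = K}"
  then obtain c where c: "x = colour_vec ix c" "card (c ` {1..n}) = K" by blast
  define \<pi> where "\<pi> = (\<lambda>k. {j \<in> {1..n}. c j = k}) ` c ` {1..n}"
  have \<pi>: "partition_on {1..n} \<pi>"
    unfolding partition_on_def disjoint_def \<pi>_def by auto
  have same: "c i = c j \<longleftrightarrow> (\<exists>C\<in>\<pi>. i \<in> C \<and> j \<in> C)" if ij: "i \<in> {1..n}" "j \<in> {1..n}" for i j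
    using ij unfolding \<pi>_def by auto
  have "K_partition n K \<pi>" "x = char_vec ix \<pi>"
    using colour_vec_eq_char_vec[OF \<pi> same] c \<pi> by (auto simp: K_partition_def)
  then show "x \<in> {char_vec ix \<pi> | \<pi>. K_partition n K \<pi>}" by blast
qed

lemma partition_polytope_eq:
  "partition_polytope ix n K = convex hull {colour_vec ix c | c. card (c ` {1..n}) = K}"
  by (simp add: partition_polytope_def char_vecs_eq_colour_vecs)

lemma colour_vec_in_polytope: "card (c ` {1..n}) = K \<Longrightarrow> colour_vec ix c \<in> partition_polytope ix n K"
  unfolding partition_polytope_eq by (rule hull_inc) blast

lemma polytope_halfspace:
  assumes "\<And>c. card (c ` {1..n}) = K \<Longrightarrow> weight n E R c \<le> r" and x: "x \<in> partition_polytope ix n K"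
  shows "coeff_vec ix E R \<bullet> x \<le> r"
proof -
  have "convex hull {colour_vec ix c | c. card (c ` {1..n}) = K} \<subseteq> {x. coeff_vec ix E R \<bullet> x \<le> r}"
    by (rule hull_minimal) (use assms(1) in \<open>auto simp: inner_colour_vec convex_halfspace_le\<close>)
  then show ?thesis using x by (auto simp: partition_polytope_eq)
qed

lemma polytope_hyperplane:
  assumes "\<And>c. card (c ` {1..n}) = K \<Longrightarrow> weight n E R c = r" and x: "x \<in> partition_polytope ix n K"
  shows "coeff_vec ix E R \<bullet> x = r"
proof -
  have "convex hull {colour_vec ix c | c. card (c ` {1..n}) = K} \<subseteq> {x. coeff_vec ix E R \<bullet> x = r}"
    by (rule hull_minimal) (use assms(1) in \<open>auto simp: inner_colour_vec convex_hyperplane\<close>)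
  then show ?thesis using x by (auto simp: partition_polytope_eq)
qed

end

section \<open>The face\<close>

definition facet_edge :: "nat \<Rightarrow> nat \<Rightarrow> nat \<Rightarrow> nat set \<Rightarrow> real" where
  "facet_edge s t1 t2 e = of_bool (e = {s, t1}) + of_bool (e = {s, t2}) - of_bool (e = {t1, t2})"

text \<open>Together with coefficient 1 on all representatives, \<open>k = 1\<close> gives the
  left-hand side of the identity in the overview, and \<open>k = 1/2\<close> the equation for at
  most two clusters.\<close>

definition low_edge :: "real \<Rightarrow> nat set \<Rightarrow> real" where
  "low_edge k e = (if e \<in> {{1, 2}, {1, 3}, {2, 3}} then - k else 0)"

lemma aff_dim_hyperplane_int:
  fixes a :: "'a::euclidean_space"
  assumes "a \<noteq> 0"
  shows "aff_dim {x. a \<bullet> x = r} = int DIM('a) - 1"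
proof -
  have "aff_dim {x. a \<bullet> x = r} = int (DIM('a) - 1)" using assms by (rule aff_dim_hyperplane)
  then show ?thesis using DIM_positive[where 'a = 'a] by linarith
qed

lemma weight_low_edge:
  assumes "3 \<le> n"
  shows "weight n (low_edge k) (\<lambda>_. 1) c = real (card (c ` {1..n})) - 3
    + (1 - k) * (of_bool (c 1 = c 2) + of_bool (c 1 = c 3) + of_bool (c 2 = c 3))
    - of_bool (c 1 = c 2 \<and> c 2 = c 3)"
proof -
  let ?L = "{{1, 2}, {1, 3}, {2, 3}} :: nat set set"
  have "(\<Sum>e\<in>edges n. low_edge k e * of_bool (monochromatic c e)) = (\<Sum>e\<in>?L. - k * of_bool (monochromatic c e))"
  proof (rule sum.mono_neutral_cong_right[OF finite_edges])
    show "?L \<subseteq> edges n" using assms by (auto intro!: edges_pairI)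
    show "\<forall>e\<in>edges n - ?L. low_edge k e * of_bool (monochromatic c e) = 0"
      unfolding low_edge_def by simp
    show "low_edge k e * of_bool (monochromatic c e) = - k * of_bool (monochromatic c e)" if "e \<in> ?L" for e
      using that unfolding low_edge_def by (simp only: if_True)
  qed
  also have "\<dots> = - k * (of_bool (c 1 = c 2) + of_bool (c 1 = c 3) + of_bool (c 2 = c 3))"
    by (simp add: doubleton_eq_iff algebra_simps)
  finally show ?thesis
    using sum_first_of_colour[OF assms, of c] by (simp add: weight_def algebra_simps)
qed

text \<open>\<open>X\<close> shows a single colour, and every other vertex adds at most one.\<close>

lemma card_image_constant_on:
  assumes "X \<subseteq> {1..n}" "i0 \<in> X" "\<And>i. i \<in> X \<Longrightarrow> c i = c i0"
  shows "card (c ` {1..n}) + card X \<le> Suc n"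
proof -
  have fX: "finite X" using assms(1) by (rule finite_subset) simp
  have "c ` {1..n} \<subseteq> insert (c i0) (c ` ({1..n} - X))" using assms(3) by blast
  then have "card (c ` {1..n}) \<le> card (insert (c i0) (c ` ({1..n} - X)))" by (intro card_mono) auto
  also have "\<dots> \<le> Suc (card ({1..n} - X))"
    using card_insert_le_m1 card_image_le[of "{1..n} - X" c] by (simp add: card_insert_if)
  also have "card ({1..n} - X) = n - card X" using assms(1) fX by (simp add: card_Diff_subset)
  finally show ?thesis using card_mono[OF _ assms(1)] by simp
qed

lemma sum_facet_edge:
  assumes "s \<in> {4..n}" "t1 \<in> {1..n}" "t2 \<in> {1..n}" "s \<noteq> t1" "s \<noteq> t2" "t1 \<noteq> t2"
  shows "(\<Sum>e\<in>edges n. facet_edge s t1 t2 e * g e) + (\<Sum>u\<in>{4..n}. of_bool (u = s) * h u)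
    = g {s, t1} + g {s, t2} - g {t1, t2} + h s"
proof -
  have delta: "(\<Sum>e\<in>edges n. of_bool (e = {i, j}) * g e) = g {i, j}"
    if "i \<in> {1..n}" "j \<in> {1..n}" "i \<noteq> j" for i j
    using that edges_pairI[OF that] by (simp add: finite_edges of_bool_def if_distrib[of "\<lambda>x. x * _"] cong: if_cong)
  have "s \<in> {1..n}" using assms(1) by simp
  moreover have "(\<Sum>u\<in>{4..n}. of_bool (u = s) * h u) = h s"
    using assms(1) by (simp add: of_bool_def if_distrib[of "\<lambda>x. x * _"] cong: if_cong)
  ultimately show ?thesis
    using assms by (simp add: facet_edge_def distrib_right left_diff_distrib sum.distrib sum_subtractf delta)
qed

lemma weight_facet_edge:
  assumes "s \<in> {4..n}" "t1 \<in> {1..n}" "t2 \<in> {1..n}" "s \<noteq> t1" "s \<noteq> t2" "t1 \<noteq> t2"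
  shows "weight n (facet_edge s t1 t2) (\<lambda>u. of_bool (u = s)) c
    = of_bool (c s = c t1) + of_bool (c s = c t2) - of_bool (c t1 = c t2) + of_bool (first_of_colour c s)"
  unfolding weight_def sum_facet_edge[OF assms] by simp

lemma weight_diff_scale:
  "weight n (\<lambda>e. E e - r * E' e) (\<lambda>u. R u - r * R' u) c = weight n E R c - r * weight n E' R' c"
  unfolding weight_def left_diff_distrib sum_subtractf mult.assoc sum_distrib_left[symmetric]
  by (simp add: distrib_left)

context
  fixes ix :: "'d::finite \<Rightarrow> coord" and n :: nat
  assumes ix: "bij_betw ix UNIV (coords n)"
begin

section \<open>Bounds on \<open>K\<close> forced by full dimension\<close>

text \<open>An equation satisfied by all characteristic vectors confines the polytope to a
  hyperplane; the nonzero coefficient at \<open>u\<close> makes the equation nontrivial.\<close>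

lemma not_full_dimensional:
  assumes "u \<in> {4..n}" "R u \<noteq> 0" "\<And>c. card (c ` {1..n}) = K \<Longrightarrow> weight n E R c = r"
  shows "\<not> full_dimensional (partition_polytope ix n K)"
proof -
  have "partition_polytope ix n K \<subseteq> {x. coeff_vec ix E R \<bullet> x = r}"
    using polytope_hyperplane[OF ix assms(3)] by blast
  then have "aff_dim (partition_polytope ix n K) \<le> aff_dim {x. coeff_vec ix E R \<bullet> x = r}"
    by (rule aff_dim_subset)
  also have "\<dots> = int DIM(real ^ 'd) - 1"
  proof -
    have "coeff_vec ix E R \<noteq> 0" by (rule coeff_vec_nonzero[OF ix assms(1)]) (rule assms(2))
    then show ?thesis by (rule aff_dim_hyperplane_int)
  qed
  finally show ?thesis by (simp add: full_dimensional_def)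
qed

lemma full_dimensional_bounds:
  assumes "4 \<le> n" and full: "full_dimensional (partition_polytope ix n K)"
  shows "3 \<le> K" "K + 2 \<le> n"
proof -
  show "3 \<le> K"
  proof (rule ccontr)
    assume "\<not> 3 \<le> K"
    \<comment> \<open>With at most two colours, 1, 2, 3 have either one equal pair or three; the
      values \<open>1/2 * 1\<close> and \<open>1/2 * 3 - 1\<close> coincide.\<close>
    have w: "weight n (low_edge (1/2)) (\<lambda>_. 1) c = real K - 5/2" if c: "card (c ` {1..n}) = K" for c
    proof -
      have "card {c 1, c 2, c 3} \<le> K" unfolding c[symmetric] by (rule card_mono) (use assms(1) in auto)
      then have "c 1 = c 2 \<or> c 1 = c 3 \<or> c 2 = c 3" using \<open>\<not> 3 \<le> K\<close> by (auto simp: card_insert_if split: if_splits)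
      then show ?thesis using weight_low_edge[of n "1/2" c] c assms(1) by auto
    qed
    have "\<not> full_dimensional (partition_polytope ix n K)"
      by (rule not_full_dimensional[of 4, OF _ _ w]) (use assms(1) in simp_all)
    then show False using full by simp
  qed
  show "K + 2 \<le> n"
  proof (rule ccontr)
    assume "\<not> K + 2 \<le> n"
    \<comment> \<open>A class containing 1, 2, 3 would leave at most \<open>n - 2\<close> colours,
      so the correction term vanishes throughout.\<close>
    have w: "weight n (low_edge 1) (\<lambda>_. 1) c = real K - 3" if c: "card (c ` {1..n}) = K" for c
    proof -
      have "\<not> (c 1 = c 2 \<and> c 2 = c 3)"
      proof
        assume eq: "c 1 = c 2 \<and> c 2 = c 3"
        have "card (c ` {1..n}) + card {1, 2, 3 :: nat} \<le> Suc n"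
          by (rule card_image_constant_on[of _ _ 1]) (use eq assms(1) in auto)
        then show False using \<open>\<not> K + 2 \<le> n\<close> c by simp
      qed
      then show ?thesis using weight_low_edge[of n 1 c] c assms(1) by simp
    qed
    have "\<not> full_dimensional (partition_polytope ix n K)"
      by (rule not_full_dimensional[of 4, OF _ _ w]) (use assms(1) in simp_all)
    then show False using full by simp
  qed
qed

section \<open>Dimension of the face\<close>

context
  fixes s t1 t2 K :: nat
  assumes V: "1 \<le> t1" "t1 < t2" "t2 < s" "3 < s" "s \<le> n" and K: "3 \<le> K" "K + 2 \<le> n"
begin

abbreviation "facet_vec \<equiv> coeff_vec ix (facet_edge s t1 t2) (\<lambda>u. of_bool (u = s))"

lemma facet_vertices: "s \<in> {4..n}" "t1 \<in> {1..n}" "t2 \<in> {1..n}" "s \<noteq> t1" "s \<noteq> t2" "t1 \<noteq> t2"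
  using V by auto

lemma inner_facet_vec: "facet_vec \<bullet> x = entry ix x (Edge {s, t1}) + entry ix x (Edge {s, t2})
                - entry ix x (Edge {t1, t2}) + entry ix x (Rep s)"
  unfolding inner_coeff_vec[OF ix] by (rule sum_facet_edge[OF facet_vertices])

lemma weight_facet_edge_le: "weight n (facet_edge s t1 t2) (\<lambda>u. of_bool (u = s)) c \<le> 1"
proof -
  have "c t1 \<noteq> c s" "c t2 \<noteq> c s" if "first_of_colour c s"
    using that V unfolding first_of_colour_def by auto
  then show ?thesis unfolding weight_facet_edge[OF facet_vertices] by auto
qed

lemma weight_facet_edge_eq:
  "face_colouring s t1 t2 c \<Longrightarrow> weight n (facet_edge s t1 t2) (\<lambda>u. of_bool (u = s)) c = 1"
proof -
  have "c t1 \<noteq> c s" "c t2 \<noteq> c s" if "first_of_colour c s"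
    using that V unfolding first_of_colour_def by auto
  moreover assume "face_colouring s t1 t2 c"
  ultimately show ?thesis unfolding weight_facet_edge[OF facet_vertices] face_colouring_def by auto
qed

lemma constant_weight_on_faceI:
  assumes "\<And>c. card (c ` {1..n}) = K \<Longrightarrow> face_colouring s t1 t2 c \<Longrightarrow> weight n E R c = b"
  shows "constant_weight_on_face n K s t1 t2 E R b"
  using assms V K by unfold_locales auto

lemma aff_dim_face:
  assumes cond: "3 < t2 \<or> K + 3 \<le> n"
  shows "aff_dim {x \<in> partition_polytope ix n K. facet_vec \<bullet> x = 1} = int DIM(real ^ 'd) - 1"
proof (rule antisym)
  have "facet_vec \<noteq> 0" by (rule coeff_vec_nonzero[OF ix facet_vertices(1)]) simp
  then have "aff_dim {x. facet_vec \<bullet> x = 1} = int DIM(real ^ 'd) - 1" by (rule aff_dim_hyperplane_int)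
  then show "aff_dim {x \<in> partition_polytope ix n K. facet_vec \<bullet> x = 1} \<le> int DIM(real ^ 'd) - 1"
    by (metis (no_types, lifting) aff_dim_subset mem_Collect_eq subsetI)
  let ?T = "{colour_vec ix c | c. card (c ` {1..n}) = K \<and> face_colouring s t1 t2 c}"
  \<comment> \<open>The zero form is an instance of the locale; it gives access to a tight colouring
    as base point.\<close>
  have "constant_weight_on_face n K s t1 t2 (\<lambda>_. 0) (\<lambda>_. 0) 0"
    by (rule constant_weight_on_faceI) (simp add: weight_def)
  from constant_weight_on_face.ex_face_colouring_pattern[OF this cond, of 0 0]
  obtain c0 where c0: "card (c0 ` {1..n}) = K" "face_colouring s t1 t2 c0" by auto
  have "int DIM(real ^ 'd) - 1 \<le> aff_dim ?T"
  proof (rule aff_dim_ge_hyperplane)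
    show "colour_vec ix c0 \<in> ?T" using c0 by blast
    fix a :: "real ^ 'd" assume a: "\<And>x. x \<in> ?T \<Longrightarrow> a \<bullet> x = a \<bullet> colour_vec ix c0"
    \<comment> \<open>The facet form has coefficient 1 at \<open>{s, t1}\<close> and value 1 at
      tight colourings, so subtracting \<open>r\<close> times it normalises the form
      \<open>a\<close> and lowers its constant by \<open>r\<close>.\<close>
    define r where "r = entry ix a (Edge {s, t1})"
    let ?E = "\<lambda>e. entry ix a (Edge e) - r * facet_edge s t1 t2 e"
    let ?R = "\<lambda>u. entry ix a (Rep u) - r * of_bool (u = s)"
    have cw: "constant_weight_on_face n K s t1 t2 ?E ?R (a \<bullet> colour_vec ix c0 - r)"
    proof (rule constant_weight_on_faceI)
      fix c assume c: "card (c ` {1..n}) = K" "face_colouring s t1 t2 c"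
      have "a \<bullet> colour_vec ix c = a \<bullet> colour_vec ix c0" by (rule a) (use c in blast)
      then show "weight n ?E ?R c = a \<bullet> colour_vec ix c0 - r"
        unfolding weight_diff_scale weight_facet_edge_eq[OF c(2)] by (simp add: inner_colour_vec'[OF ix])
    qed
    have "?E {s, t1} = 0" using facet_vertices by (simp add: r_def facet_edge_def doubleton_eq_iff)
    note zero = constant_weight_on_face.weights_zero[OF cw this cond]
    have E: "entry ix a (Edge e) = r * facet_edge s t1 t2 e" if "e \<in> edges n" for e
      using zero(1)[OF that] by simp
    have R: "entry ix a (Rep u) = r * of_bool (u = s)" if "u \<in> {4..n}" for u
      using zero(2)[OF that] by simp
    have "a $ d = (r *\<^sub>R facet_vec) $ d" for d
      by (cases d rule: ix_cases[OF ix]) (use E R inv_ix[OF ix, of d] in \<open>auto simp: coeff_vec_def entry_def\<close>)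
    then have "a = r *\<^sub>R facet_vec" by (simp add: vec_eq_iff)
    then show "a \<in> span {facet_vec}" by (simp add: span_base span_scale)
  qed
  also have "\<dots> \<le> aff_dim {x \<in> partition_polytope ix n K. facet_vec \<bullet> x = 1}"
    by (rule aff_dim_subset)
      (use colour_vec_in_polytope[OF ix] weight_facet_edge_eq in \<open>auto simp: inner_colour_vec[OF ix]\<close>)
  finally show "int DIM(real ^ 'd) - 1 \<le> aff_dim {x \<in> partition_polytope ix n K. facet_vec \<bullet> x = 1}" .
qed

text \<open>Here no tight colouring with \<open>K\<close> colours puts 1, 2, 3 into one class, so
  the face also lies in a hyperplane given by \<open>low_edge 1\<close>, which does not contain the
  hyperplane of the inequality.\<close>

lemma aff_dim_face_less:
  assumes t2: "t2 \<le> 3" and Kn: "K + 2 = n"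
  shows "aff_dim {x \<in> partition_polytope ix n K. facet_vec \<bullet> x = 1} < int DIM(real ^ 'd) - 1"
proof -
  let ?g = "coeff_vec ix (low_edge 1) (\<lambda>_. 1)"
  have n: "3 \<le> n" using K by simp
  have g: "weight n (low_edge 1) (\<lambda>_. 1) c = real K - 3 - of_bool (c 1 = c 2 \<and> c 2 = c 3)"
    if "card (c ` {1..n}) = K" for c
    using weight_low_edge[OF n, of 1 c] that by simp
  \<comment> \<open>On the polytope the left-hand side minus 1 is at most \<open>g \<bullet> x - (K - 3)\<close>, which is at most 0,
    so equality in the facet inequality forces equality in the second one.\<close>
  have fg: "weight n (\<lambda>e. facet_edge s t1 t2 e - 1 * low_edge 1 e) (\<lambda>u. of_bool (u = s) - 1 * 1) c \<le> 4 - real K"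
    if c: "card (c ` {1..n}) = K" for c
  proof (cases "c 1 = c 2 \<and> c 2 = c 3")
    case True
    have t: "c i = c 1" if "i \<in> {1, 2, 3, s} - {s}" for i using True that by auto
    have "t1 \<in> {1, 2, 3, s} - {s}" "t2 \<in> {1, 2, 3, s} - {s}" using t2 V by auto
    then have t: "c t1 = c 1" "c t2 = c 1" using t by blast+
    \<comment> \<open>With \<open>s\<close> in the class of 1, 2, 3 at most
      \<open>n - 3 = K - 1\<close> colours could occur.\<close>
    have "c s \<noteq> c 1"
    proof
      assume "c s = c 1"
      then have "card (c ` {1..n}) + card {1, 2, 3, s} \<le> Suc n"
        using True V by (intro card_image_constant_on[of _ _ 1]) auto
      moreover have "card {1, 2, 3, s} = 4" using V by simp
      ultimately show False using c Kn by simp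
    qed
    then show ?thesis
      unfolding weight_diff_scale g[OF c] weight_facet_edge[OF facet_vertices] using t True by auto
  next
    case False
    then have 0: "of_bool (c 1 = c 2 \<and> c 2 = c 3) = (0 :: real)" by (simp only: of_bool_eq_0_iff not_False_eq_True)
    show ?thesis
      unfolding weight_diff_scale g[OF c] 0 using weight_facet_edge_le[of c] by simp
  qed
  have sub: "{x \<in> partition_polytope ix n K. facet_vec \<bullet> x = 1} \<subseteq> {x. facet_vec \<bullet> x = 1} \<inter> {x. ?g \<bullet> x = real K - 3}"
  proof
    fix x assume "x \<in> {x \<in> partition_polytope ix n K. facet_vec \<bullet> x = 1}"
    then have x: "x \<in> partition_polytope ix n K" "facet_vec \<bullet> x = 1" by auto
    have "?g \<bullet> x \<le> real K - 3" by (rule polytope_halfspace[OF ix _ x(1)]) (simp add: g)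
    moreover have "coeff_vec ix (\<lambda>e. facet_edge s t1 t2 e - 1 * low_edge 1 e) (\<lambda>u. of_bool (u = s) - 1 * 1) \<bullet> x
        \<le> 4 - real K" by (rule polytope_halfspace[OF ix fg x(1)])
    then have "facet_vec \<bullet> x - ?g \<bullet> x \<le> 4 - real K"
      unfolding inner_coeff_vec[OF ix] by (simp add: algebra_simps sum_subtractf)
    ultimately show "x \<in> {x. facet_vec \<bullet> x = 1} \<inter> {x. ?g \<bullet> x = real K - 3}" using x by simp
  qed
  \<comment> \<open>A point on the first hyperplane but not on the second: its two entries sum to 1,
    as the facet form requires, while the second form sees only \<open>K - 2\<close> at
    \<open>Rep s\<close>.\<close>
  define y where "y = coeff_vec ix (\<lambda>e. (3 - real K) * of_bool (e = {s, t1})) (\<lambda>u. (real K - 2) * of_bool (u = s))"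
  have yE: "entry ix y (Edge e) = (3 - real K) * of_bool (e = {s, t1})" if "e \<in> edges n" for e
    using that by (simp add: y_def entry_coeff_vec[OF ix])
  have yR: "entry ix y (Rep u) = (real K - 2) * of_bool (u = s)" if "u \<in> {4..n}" for u
    using that by (simp add: y_def entry_coeff_vec[OF ix])
  have "{s, t1} \<in> edges n" "{s, t2} \<in> edges n" "{t1, t2} \<in> edges n" using facet_vertices V by (auto intro!: edges_pairI)
  then have fy: "facet_vec \<bullet> y = 1"
    unfolding inner_facet_vec using facet_vertices yE yR by (simp add: doubleton_eq_iff)
  have "low_edge 1 {s, t1} = 0" using V(4) by (auto simp: low_edge_def doubleton_eq_iff)
  then have "(\<Sum>e\<in>edges n. low_edge 1 e * entry ix y (Edge e)) = 0"
    by (intro sum.neutral) (auto simp: yE)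
  moreover have "(\<Sum>u\<in>{4..n}. 1 * entry ix y (Rep u)) = (\<Sum>u\<in>{4..n}. if u = s then real K - 2 else 0)"
    by (rule sum.cong) (auto simp: yR)
  moreover have "\<dots> = real K - 2" using facet_vertices(1) by simp
  ultimately have gy: "?g \<bullet> y = real K - 2"
    unfolding inner_coeff_vec[OF ix] by simp
  have "facet_vec \<noteq> 0" by (rule coeff_vec_nonzero[OF ix facet_vertices(1)]) simp
  then have hyp: "aff_dim {x. facet_vec \<bullet> x = 1} = int DIM(real ^ 'd) - 1" by (rule aff_dim_hyperplane_int)
  have "aff_dim {x \<in> partition_polytope ix n K. facet_vec \<bullet> x = 1} \<le> aff_dim ({x. facet_vec \<bullet> x = 1} \<inter> {x. ?g \<bullet> x = real K - 3})"
    by (rule aff_dim_subset[OF sub])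
  also have "\<dots> < int DIM(real ^ 'd) - 1"
  proof -
    have "\<not> {x. facet_vec \<bullet> x = 1} \<subseteq> {x. ?g \<bullet> x = real K - 3}" using fy gy by auto
    moreover have "- 1 < int DIM(real ^ 'd) - 1" by simp
    ultimately show ?thesis
      using aff_dim_affine_Int_hyperplane[OF affine_hyperplane[of facet_vec 1], of ?g "real K - 3"] hyp by auto
  qed
  finally show ?thesis .
qed

end

end

theorem theorem8p1:
  fixes n K s t1 t2 :: nat
    and ix :: "'d::finite \<Rightarrow> coord"
  assumes ix: "bij_betw ix UNIV (coords n)"
    and V: "s \<in> {1..n}" "t1 \<in> {1..n}" "t2 \<in> {1..n}"
    and order: "s > t2" "t2 > t1" "s > 3"
    and full: "full_dimensional (partition_polytope ix n K)"
  shows "facet_defining (partition_polytope ix n K)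
           (\<lambda>x. entry ix x (Edge {s, t1}) + entry ix x (Edge {s, t2})
                - entry ix x (Edge {t1, t2}) + entry ix x (Rep s)) 1
         \<longleftrightarrow> t2 > 3 \<or> K \<le> n - 3"
proof -
  have n: "4 \<le> n" and V': "1 \<le> t1" "t1 < t2" "t2 < s" "3 < s" "s \<le> n" using V order by auto
  note K = full_dimensional_bounds[OF ix n full]
  let ?P = "partition_polytope ix n K"
  let ?f = "coeff_vec ix (facet_edge s t1 t2) (\<lambda>u. of_bool (u = s))"
  have "?f \<bullet> x \<le> 1" if "x \<in> ?P" for x
    by (rule polytope_halfspace[OF ix _ that]) (rule weight_facet_edge_le[OF ix V' K])
  then have "facet_defining ?P (\<lambda>x. ?f \<bullet> x) 1 \<longleftrightarrow> aff_dim {x \<in> ?P. ?f \<bullet> x = 1} = int DIM(real ^ 'd) - 1"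
    using full by (simp add: facet_defining_def full_dimensional_def)
  also have "\<dots> \<longleftrightarrow> t2 > 3 \<or> K \<le> n - 3"
  \<comment> \<open>The case condition avoids the truncated subtraction \<open>n - 3\<close>; both
    versions agree because \<open>4 \<le> n\<close>.\<close>
  proof (cases "3 < t2 \<or> K + 3 \<le> n")
    case True
    then have "t2 > 3 \<or> K \<le> n - 3" by auto
    then show ?thesis using aff_dim_face[OF ix V' K True] by simp
  next
    case False
    then have "t2 \<le> 3" "K + 2 = n" "\<not> K \<le> n - 3" using K n by auto
    then show ?thesis using aff_dim_face_less[OF ix V' K] by auto
  qed
  finally show ?thesis unfolding inner_facet_vec[OF ix V' K] .
qed

end
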